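(* Let $\alpha,\beta$ be algebraic numbers with $\alpha \ne 0,1$ and $i\beta \notin \mathbb{Q}$. Then the numbers $1$, $\cos(\beta \ln \alpha)$ and $\sin(\beta\ln\alpha)$ are linearly independent over the field of algebraic numbers. In particular, $\cos(\beta\ln\alpha)$ and $\sin(\beta\ln\alpha)$ are transcendental.
   Context: $\ln$ denotes the principal value of the complex logarithm (argument in $(-\pi,\pi]$). A complex number is algebraic if it is a root of a non-trivial polynomial with rational coefficients; otherwise it is transcendental. *)

theory Defs
  imports "HOL-Analysis.Analysis" "HOL-Computational_Algebra.Computational_Algebra"
begin

text \<open>
  Linear independence of a finite family over a subfield \<open>K\<close> of an ambient field,
  where the subfield is given as a set of elements rather than as a type.
\<close>

definition lin_indep_over :: "'a::field set \<Rightarrow> 'a list \<Rightarrow> bool" where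
  "lin_indep_over K vs \<longleftrightarrow>
     (\<forall>c. (\<forall>i < length vs. c i \<in> K) \<longrightarrow> (\<Sum>i < length vs. c i * vs ! i) = 0 \<longrightarrow>
          (\<forall>i < length vs. c i = 0))"

end

theory Submission
  imports Defs "HOL-Complex_Analysis.Complex_Analysis" "Jordan_Normal_Form.Char_Poly"
begin

text \<open>
  Put \<open>w = exp (\<i> * \<beta> * Ln \<alpha>)\<close>. Since \<open>2 * cos x = w + 1 / w\<close> and \<open>2 * \<i> * sin x = w - 1 / w\<close>, a nontrivial
  relation between \<open>1\<close>, \<open>cos x\<close> and \<open>sin x\<close> with algebraic coefficients is a nontrivial quadratic equation
  for \<open>w\<close>, so \<open>w\<close> would be algebraic, contradicting the Gelfond--Schneider theorem.

  That theorem is proved by Gelfond's method. If \<open>\<alpha> = exp l\<close>, \<open>b\<close> and \<open>\<gamma> = exp (b * l)\<close> are all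
  algebraic, then up to a common denominator they lie in a ring \<open>R\<close> that is spanned over the integers by
  \<open>N\<close> elements. Multiplication by \<open>\<xi> \<in> R\<close> is given by an integer matrix, and the product of the nonzero
  eigenvalues of an integer matrix is a nonzero integer up to sign; this bounds \<open>norm \<xi>\<close> from below for
  \<open>\<xi> \<noteq> 0\<close> without any Galois theory. Siegel's lemma yields a function
  \<open>F z = (\<Sum>i, j < q. p i j * exp ((i + j * b) * l * z))\<close> with small integer coefficients that vanishes to
  high order at \<open>0, \<dots>, M - 1\<close>. If \<open>T\<close> is the least order of a nonvanishing derivative at one of these points,
  the maximum principle on a disc of radius \<open>sqrt T\<close> makes this derivative smaller than the lower bound
  permits, once \<open>M = 2 * N + 4\<close> and \<open>T\<close> is large.
\<close>

section \<open>Finitely generated rings of algebraic integers\<close>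

global_interpretation int_mod: Modules.module "\<lambda>(n::int) (z::complex). of_int n * z"
  by unfold_locales (auto simp: algebra_simps)

text \<open>These conditions make \<open>int_mod.span B\<close> a subring of the complex numbers
  that is finitely generated as an additive group. \<open>B\<close> is just a generating set,
  possibly linearly dependent over the integers, so coordinates may be ambiguous.\<close>

definition order_basis :: "complex set \<Rightarrow> bool" where
  "order_basis B \<longleftrightarrow> finite B \<and> 1 \<in> B \<and> (\<forall>x\<in>B. \<forall>y\<in>B. x * y \<in> int_mod.span B)"

lemma span_times_closed:
  assumes "\<And>x. x \<in> A \<Longrightarrow> x * y \<in> int_mod.span B" and "x \<in> int_mod.span A"
  shows "x * y \<in> int_mod.span B"
  using assms(2)
proof (induction rule: int_mod.span_induct_alt)
  case base
  then show ?case by (simp add: int_mod.span_zero)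
next
  case (step c x y')
  have "of_int c * (x * y) + y' * y \<in> int_mod.span B"
    using step assms(1) by (intro int_mod.span_add int_mod.span_scale) auto
  then show ?case by (simp add: algebra_simps)
qed

lemma order_basis_span_mult:
  assumes "order_basis B" "x \<in> int_mod.span B" "y \<in> int_mod.span B"
  shows "x * y \<in> int_mod.span B"
proof (rule span_times_closed[OF _ assms(2)])
  fix b assume b: "b \<in> B"
  have "y * b \<in> int_mod.span B"
    by (rule span_times_closed[OF _ assms(3)]) (use assms(1) b in \<open>auto simp: order_basis_def\<close>)
  then show "b * y \<in> int_mod.span B" by (simp add: mult.commute)
qed

lemma order_basis_span_of_int:
  assumes "order_basis B"
  shows "of_int n \<in> int_mod.span B"
  using int_mod.span_scale[OF int_mod.span_base[of 1 B], of n] assms by (simp add: order_basis_def)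

text \<open>The monic equation is solved for its top power, the form in which it reduces
  \<open>a ^ n\<close> with \<open>n \<ge> d\<close> to lower powers.\<close>

definition integral_over_int :: "complex \<Rightarrow> bool" where
  "integral_over_int a \<longleftrightarrow> (\<exists>d r. d > 0 \<and> a ^ d = (\<Sum>i<d. of_int (r i) * a ^ i))"

text \<open>The products \<open>b * a ^ j\<close> with \<open>j < d\<close> generate the larger
  ring, since the monic equation for \<open>a\<close> lowers every higher power.\<close>

lemma order_basis_adjoin:
  assumes B: "order_basis B" and a: "integral_over_int a"
  shows "\<exists>B'. order_basis B' \<and> B \<subseteq> B' \<and> a \<in> int_mod.span B'"
proof -
  obtain d r where d: "d > 0" and r: "a ^ d = (\<Sum>i<d. of_int (r i) * a ^ i)"
    using a by (auto simp: integral_over_int_def)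
  define B' where "B' = (\<lambda>(b, j). b * a ^ j) ` (B \<times> {..<d})"
  have base: "b * a ^ n \<in> int_mod.span B'" if "b \<in> B" for b n
  proof (induction n rule: less_induct)
    case (less n)
    show ?case
    proof (cases "n < d")
      case True
      then show ?thesis using that by (intro int_mod.span_base) (auto simp: B'_def)
    next
      case False
      have "b * a ^ n = b * (a ^ d * a ^ (n - d))"
        using False by (simp flip: power_add)
      \<comment> \<open>All exponents \<open>n - d + i\<close> are below \<open>n\<close>, so the
        induction hypothesis applies to each summand.\<close>
      also have "\<dots> = (\<Sum>i<d. of_int (r i) * (b * a ^ (n - d + i)))"
        by (simp add: r sum_distrib_left sum_distrib_right power_add mult_ac)
      also have "\<dots> \<in> int_mod.span B'"
        using False by (intro int_mod.span_sum int_mod.span_scale less) auto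
      finally show ?thesis .
    qed
  qed
  have step: "x * a ^ n \<in> int_mod.span B'" if "x \<in> int_mod.span B" for x n
    by (rule span_times_closed[OF base that])
  have "order_basis B'"
    unfolding order_basis_def
  proof (intro conjI ballI)
    show "finite B'" using B by (auto simp: B'_def order_basis_def)
    have "1 = (\<lambda>(b, j). b * a ^ j) (1, 0)" by simp
    moreover have "(1, 0) \<in> B \<times> {..<d}" using B d by (auto simp: order_basis_def)
    ultimately show "1 \<in> B'" unfolding B'_def by blast
  next
    fix x y assume "x \<in> B'" "y \<in> B'"
    then obtain b j c k where "x = b * a ^ j" "y = c * a ^ k" "b \<in> B" "c \<in> B"
      by (auto simp: B'_def)
    moreover have "b * c * a ^ (j + k) \<in> int_mod.span B'"
      using B \<open>b \<in> B\<close> \<open>c \<in> B\<close> by (intro step) (auto simp: order_basis_def)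
    ultimately show "x * y \<in> int_mod.span B'" by (simp add: power_add mult_ac)
  qed
  moreover have "B \<subseteq> B'"
  proof
    fix b assume "b \<in> B"
    then have "(b, 0) \<in> B \<times> {..<d}" using d by auto
    moreover have "b = (\<lambda>(b, j). b * a ^ j) (b, 0)" by simp
    ultimately show "b \<in> B'" unfolding B'_def by blast
  qed
  moreover have "a \<in> int_mod.span B'" using base[of 1 1] B by (simp add: order_basis_def)
  ultimately show ?thesis by blast
qed

lemma order_basis_exists:
  assumes "finite A" "\<And>a. a \<in> A \<Longrightarrow> integral_over_int a"
  shows "\<exists>B. order_basis B \<and> A \<subseteq> int_mod.span B"
  using assms
proof (induction A rule: finite_induct)
  case empty
  have "order_basis {1}" by (auto simp: order_basis_def intro: int_mod.span_base)
  then show ?case by blast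
next
  case (insert a A)
  then obtain B where B: "order_basis B" "A \<subseteq> int_mod.span B" by auto
  obtain B' where "order_basis B'" "B \<subseteq> B'" "a \<in> int_mod.span B'"
    using order_basis_adjoin[OF B(1)] insert.prems by blast
  then show ?case using B int_mod.span_mono[of B B'] by blast
qed

text \<open>Multiplying an integer equation of degree \<open>n\<close> with leading coefficient
  \<open>c\<close> by \<open>c ^ (n - 1)\<close> turns it into a monic equation for
  \<open>c * x\<close>.\<close>

lemma algebraic_imp_integral_multiple:
  assumes "algebraic x"
  shows "\<exists>D::int. D \<noteq> 0 \<and> integral_over_int (of_int D * x)"
proof -
  obtain p :: "int poly" where p: "p \<noteq> 0" "poly (map_poly of_int p) x = 0"
    using assms by (erule algebraicE')
  define n where "n = degree p"
  define c where "c = lead_coeff p"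
  have c: "c \<noteq> 0" using p by (simp add: c_def)
  have eq: "(\<Sum>i\<le>n. of_int (coeff p i) * x ^ i) = 0"
    using p(2) by (simp add: poly_altdef n_def)
  have "n > 0"
  proof (rule ccontr)
    assume "\<not> n > 0"
    then show False using eq c by (simp add: c_def n_def)
  qed
  then obtain m where m: "n = Suc m" using gr0_implies_Suc by blast
  have "(of_int c * x) ^ n = of_int c ^ m * (of_int c * x ^ n)"
    by (simp add: m power_mult_distrib)
  also have "of_int c * x ^ n = - (\<Sum>i<n. of_int (coeff p i) * x ^ i)"
  proof -
    have "{..n} = insert n {..<n}" by auto
    then show ?thesis using eq by (simp add: c_def n_def add_eq_0_iff2)
  qed
  also have "of_int c ^ m * - (\<Sum>i<n. of_int (coeff p i) * x ^ i) =
      (\<Sum>i<n. of_int (- coeff p i * c ^ (m - i)) * (of_int c * x) ^ i)"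
    unfolding sum_negf[symmetric] sum_distrib_left
  proof (rule sum.cong[OF refl])
    fix i assume "i \<in> {..<n}"
    then have "of_int c ^ m = (of_int c ^ (m - i) * of_int c ^ i :: complex)"
      using m by (simp flip: power_add)
    then show "of_int c ^ m * - (of_int (coeff p i) * x ^ i) =
        of_int (- coeff p i * c ^ (m - i)) * (of_int c * x) ^ i"
      by (simp add: power_mult_distrib)
  qed
  finally have "integral_over_int (of_int c * x)"
    unfolding integral_over_int_def using \<open>n > 0\<close>
    by (intro exI[of _ n] exI[of _ "\<lambda>i. - coeff p i * c ^ (m - i)"] conjI)
  then show ?thesis using c by blast
qed

lemma integer_coordinates:
  assumes "finite B" "z \<in> int_mod.span B"
  obtains x where "z = (\<Sum>b\<in>B. of_int (x b) * b)"
  using assms int_mod.span_finite[of B] by auto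

section \<open>Bounds for eigenvalues of integer matrices\<close>

text \<open>Read the eigenvector equation in a coordinate where the eigenvector has largest modulus:
  the row sum of the entries then dominates \<open>norm e\<close>.\<close>

lemma eigenvalue_norm_le:
  fixes A :: "complex mat"
  assumes A: "A \<in> carrier_mat n n" and ev: "eigenvalue A e"
    and bound: "\<And>i j. i < n \<Longrightarrow> j < n \<Longrightarrow> norm (A $$ (i, j)) \<le> H"
  shows "norm e \<le> real n * H"
proof -
  obtain v where v: "v \<in> carrier_vec n" "v \<noteq> 0\<^sub>v n" "A *\<^sub>v v = e \<cdot>\<^sub>v v"
    using ev A by (auto simp: eigenvalue_def eigenvector_def)
  have "\<exists>i<n. v $ i \<noteq> 0"
  proof (rule ccontr)
    assume "\<not> ?thesis"
    then have "v = 0\<^sub>v n" using v(1) by (intro eq_vecI) auto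
    then show False using v(2) by simp
  qed
  then obtain i0 where i0: "i0 < n" "v $ i0 \<noteq> 0" by blast
  define m where "m = Max ((\<lambda>i. norm (v $ i)) ` {..<n})"
  have "m \<in> (\<lambda>i. norm (v $ i)) ` {..<n}"
    unfolding m_def using i0 by (intro Max_in) auto
  then obtain i where i: "i < n" "m = norm (v $ i)" by auto
  have le: "norm (v $ j) \<le> m" if "j < n" for j
    unfolding m_def using that by (intro Max_ge) auto
  have "m > 0" using le[OF i0(1)] i0(2) by (simp add: order_less_le_trans[of 0 "norm (v $ i0)"])
  have "norm e * m = norm ((e \<cdot>\<^sub>v v) $ i)" using i v by (simp add: norm_mult)
  also have "\<dots> = norm (\<Sum>j<n. A $$ (i, j) * v $ j)"
    using i v(1) A by (simp flip: v(3) add: scalar_prod_def atLeast0LessThan)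
  also have "\<dots> \<le> (\<Sum>j<n. H * m)"
    by (intro sum_norm_le) (use bound le i in \<open>auto simp: norm_mult intro!: mult_mono order.trans[OF norm_ge_zero]\<close>)
  finally have "norm e * m \<le> real n * H * m" by simp
  then show ?thesis using \<open>m > 0\<close> by simp
qed

text \<open>The lowest nonvanishing coefficient of the characteristic polynomial is a nonzero
  integer and, up to sign, the product of the nonzero eigenvalues. Each of these is at most
  \<open>n * H\<close> in modulus, so none can be very small.\<close>

lemma int_mat_eigenvalue_lower_bound:
  fixes A :: "int mat" and e :: complex
  assumes A: "A \<in> carrier_mat n n" and ev: "eigenvalue (map_mat of_int A) e" and "e \<noteq> 0"
    and bound: "\<And>i j. i < n \<Longrightarrow> j < n \<Longrightarrow> real_of_int \<bar>A $$ (i, j)\<bar> \<le> H" and H: "H \<ge> 1"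
  shows "1 / (real n * H) ^ n \<le> norm e"
proof -
  let ?A = "map_mat of_int A :: complex mat"
  have cA: "?A \<in> carrier_mat n n" using A by simp
  have n: "n > 0" using eigenvalue_imp_nonzero_dim[OF cA ev] .
  define R where "R = real n * H"
  have "1 * 1 \<le> R" unfolding R_def using n H by (intro mult_mono) auto
  then have R: "R \<ge> 1" by simp
  obtain as where as: "char_poly ?A = (\<Prod>a\<leftarrow>as. [:- a, 1:])" "length as = n"
    using char_poly_factorized[OF cA] by blast
  have root: "norm a \<le> R" if "a \<in> set as" for a
  proof -
    have "poly (char_poly ?A) a = 0"
      unfolding as(1) poly_prod_list using that by (auto simp: prod_list_zero_iff)
    then have "eigenvalue ?A a" using eigenvalue_root_char_poly[OF cA] by simp
    then show ?thesis
      unfolding R_def by (rule eigenvalue_norm_le[OF cA]) (use A bound in \<open>auto\<close>)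
  qed
  have e: "e \<in> set as"
  proof -
    have "poly (char_poly ?A) e = 0" using ev eigenvalue_root_char_poly[OF cA] by simp
    then show ?thesis unfolding as(1) poly_prod_list by (auto simp: prod_list_zero_iff)
  qed
  \<comment> \<open>\<open>bs\<close> lists the nonzero eigenvalues with multiplicity and
    \<open>k\<close> is the multiplicity of the eigenvalue 0, so
    \<open>coeff (char_poly ?A) k\<close> is the constant term of \<open>q\<close>.\<close>
  define bs where "bs = filter (\<lambda>a. a \<noteq> 0) as"
  define q where "q = (\<Prod>a\<leftarrow>bs. [:- a, 1:])"
  define k where "k = length (filter (\<lambda>a. a = 0) as)"
  have "(\<Prod>a\<leftarrow>as. [:- a, 1:]) = monom 1 k * q"
    unfolding k_def q_def bs_def
  proof (induction as)
    case (Cons a as)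
    let ?k = "length (filter (\<lambda>a. a = 0) as)" and ?q = "\<Prod>a\<leftarrow>filter (\<lambda>a. a \<noteq> 0) as. [:- a, 1:]"
    have IH: "(\<Prod>a\<leftarrow>a # as. [:- a, 1:]) = [:- a, 1:] * (monom 1 ?k * ?q)"
      by (simp only: list.map prod_list.Cons Cons)
    show ?case
    proof (cases "a = 0")
      case True
      then have "[:- a, 1:] = monom 1 1" by (simp add: monom_altdef)
      then have "[:- a, 1:] * (monom 1 ?k * ?q) = monom 1 (Suc ?k) * ?q"
        by (simp only: mult.assoc[symmetric] mult_monom) simp
      then show ?thesis unfolding IH using True by simp
    next
      case False
      then have "filter (\<lambda>a. a = 0) (a # as) = filter (\<lambda>a. a = 0) as"
        "filter (\<lambda>a. a \<noteq> 0) (a # as) = a # filter (\<lambda>a. a \<noteq> 0) as" by auto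
      then show ?thesis unfolding IH by (simp only: list.map prod_list.Cons mult.left_commute)
    qed
  qed simp
  then have "coeff (char_poly ?A) k = coeff q 0"
    unfolding as(1) by (simp add: coeff_monom_mult)
  also have "\<dots> = (\<Prod>a\<leftarrow>bs. - a)"
    unfolding poly_0_coeff_0[symmetric] q_def poly_prod_list by (simp add: o_def)
  finally have eq: "of_int (coeff (char_poly A) k) = (\<Prod>a\<leftarrow>bs. - a)"
    using of_int_hom.char_poly_hom[OF A, where ?'a = complex] by simp
  have "(\<Prod>a\<leftarrow>bs. - a) \<noteq> 0" by (auto simp: prod_list_zero_iff bs_def)
  then have "coeff (char_poly A) k \<noteq> 0" unfolding eq[symmetric] by simp
  then have "\<bar>coeff (char_poly A) k\<bar> \<ge> 1" by linarith
  then have "1 \<le> norm (\<Prod>a\<leftarrow>bs. - a)" unfolding eq[symmetric] norm_of_int by linarith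
  also have "\<dots> = (\<Prod>a\<leftarrow>bs. norm a)" by (induction bs) (auto simp: norm_mult)
  \<comment> \<open>A single occurrence of \<open>e\<close> is split off. The other factors are
    bounded by \<open>R\<close>, and \<open>R \<ge> 1\<close> allows their number to be raised to
    \<open>n\<close>.\<close>
  also have "\<dots> = norm e * (\<Prod>a\<leftarrow>remove1 e bs. norm a)"
    by (rule prod_list_map_remove1) (use e \<open>e \<noteq> 0\<close> in \<open>auto simp: bs_def\<close>)
  also have "\<dots> \<le> norm e * R ^ length (remove1 e bs)"
  proof (rule mult_left_mono)
    have "(\<Prod>a\<leftarrow>cs. norm a) \<le> R ^ length cs" if "set cs \<subseteq> set as" for cs
      using that R by (induction cs) (auto intro!: mult_mono prod_list_nonneg root)
    moreover have "set (remove1 e bs) \<subseteq> set as"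
      using set_remove1_subset[of e bs] by (auto simp: bs_def)
    ultimately show "(\<Prod>a\<leftarrow>remove1 e bs. norm a) \<le> R ^ length (remove1 e bs)" by blast
  qed simp
  also have "\<dots> \<le> norm e * R ^ n"
  proof (intro mult_left_mono power_increasing)
    have "length (remove1 e bs) \<le> length bs" by (simp add: length_remove1)
    also have "\<dots> \<le> length as" by (simp add: bs_def)
    finally show "length (remove1 e bs) \<le> n" using as(2) by simp
  qed (use R in auto)
  finally show ?thesis unfolding R_def[symmetric] using R by (simp add: divide_le_eq)
qed

section \<open>Sizes of ring elements and a Liouville inequality\<close>

text \<open>The l1 norm of some coordinate vector is bounded; the quantifier over \<open>x\<close>
  is there because \<open>z\<close> may have several representations over \<open>B\<close>.\<close>

definition size_le :: "complex set \<Rightarrow> real \<Rightarrow> complex \<Rightarrow> bool" where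
  "size_le B H z \<longleftrightarrow>
     (\<exists>x. z = (\<Sum>b\<in>B. of_int (x b) * b) \<and> (\<Sum>b\<in>B. real_of_int \<bar>x b\<bar>) \<le> H)"

lemma size_le_mono: "size_le B H z \<Longrightarrow> H \<le> H' \<Longrightarrow> size_le B H' z"
  unfolding size_le_def by force

lemma size_le_nonneg: "size_le B H z \<Longrightarrow> H \<ge> 0"
  unfolding size_le_def by (meson abs_ge_zero of_int_0_le_iff order_trans sum_nonneg)

lemma size_le_zero: "size_le B 0 0"
  unfolding size_le_def by (intro exI[of _ "\<lambda>_. 0"]) auto

lemma size_le_add:
  assumes "size_le B H z" "size_le B H' w"
  shows "size_le B (H + H') (z + w)"
proof -
  obtain x y where x: "z = (\<Sum>b\<in>B. of_int (x b) * b)" "(\<Sum>b\<in>B. real_of_int \<bar>x b\<bar>) \<le> H"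
    and y: "w = (\<Sum>b\<in>B. of_int (y b) * b)" "(\<Sum>b\<in>B. real_of_int \<bar>y b\<bar>) \<le> H'"
    using assms by (auto simp: size_le_def)
  have "(\<Sum>b\<in>B. real_of_int \<bar>x b + y b\<bar>) \<le> (\<Sum>b\<in>B. real_of_int \<bar>x b\<bar> + real_of_int \<bar>y b\<bar>)"
    by (intro sum_mono) linarith
  then have "(\<Sum>b\<in>B. real_of_int \<bar>x b + y b\<bar>) \<le> H + H'"
    using x(2) y(2) by (simp add: sum.distrib)
  then show ?thesis
    unfolding size_le_def using x(1) y(1)
    by (intro exI[of _ "\<lambda>b. x b + y b"]) (simp add: algebra_simps sum.distrib)
qed

lemma size_le_scale:
  assumes "size_le B H z"
  shows "size_le B (real_of_int \<bar>n\<bar> * H) (of_int n * z)"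
proof -
  obtain x where x: "z = (\<Sum>b\<in>B. of_int (x b) * b)" "(\<Sum>b\<in>B. real_of_int \<bar>x b\<bar>) \<le> H"
    using assms by (auto simp: size_le_def)
  have "(\<Sum>b\<in>B. real_of_int \<bar>n * x b\<bar>) = real_of_int \<bar>n\<bar> * (\<Sum>b\<in>B. real_of_int \<bar>x b\<bar>)"
    by (simp add: abs_mult sum_distrib_left)
  also have "\<dots> \<le> real_of_int \<bar>n\<bar> * H" using x by (intro mult_left_mono) auto
  finally show ?thesis
    unfolding size_le_def using x(1)
    by (intro exI[of _ "\<lambda>b. n * x b"]) (simp add: sum_distrib_left mult_ac)
qed

lemma size_le_sum:
  assumes "\<And>i. i \<in> I \<Longrightarrow> size_le B (h i) (z i)"
  shows "size_le B (\<Sum>i\<in>I. h i) (\<Sum>i\<in>I. z i)"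
proof (cases "finite I")
  case True
  then show ?thesis using assms
    by (induction I rule: finite_induct) (auto intro: size_le_zero size_le_add)
qed (simp add: size_le_zero)

lemma size_le_base:
  assumes "finite B" "b \<in> B"
  shows "size_le B 1 b"
proof -
  have "b = (\<Sum>c\<in>B. of_int (if c = b then 1 else 0) * c)"
  proof -
    have "(\<Sum>c\<in>B. of_int (if c = b then 1 else 0) * c) = (\<Sum>c\<in>B. if c = b then b else 0)"
      by (intro sum.cong) auto
    then show ?thesis using assms by simp
  qed
  moreover have "(\<Sum>c\<in>B. real_of_int \<bar>if c = b then 1 else 0\<bar>) = (\<Sum>c\<in>B. if c = b then 1 else 0)"
    by (intro sum.cong) auto
  then have "(\<Sum>c\<in>B. real_of_int \<bar>if c = b then 1 else 0\<bar>) \<le> 1" using assms by simp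
  ultimately show ?thesis
    unfolding size_le_def by (intro exI[of _ "\<lambda>c. if c = b then 1 else 0"] conjI)
qed

lemma size_le_span:
  assumes "finite B" "z \<in> int_mod.span B"
  shows "\<exists>H. size_le B H z"
proof -
  obtain x where "z = (\<Sum>b\<in>B. of_int (x b) * b)" using integer_coordinates[OF assms] .
  then have "size_le B (\<Sum>b\<in>B. real_of_int \<bar>x b\<bar>) z" unfolding size_le_def by blast
  then show ?thesis ..
qed

text \<open>Expanding both factors over \<open>B\<close> leaves the finitely many products of two
  generators, whose sizes are dominated by one constant.\<close>

lemma order_basis_size_mult:
  assumes B: "order_basis B"
  shows "\<exists>C\<ge>1. \<forall>z w H H'. size_le B H z \<longrightarrow> size_le B H' w \<longrightarrow> size_le B (C * H * H') (z * w)"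
proof -
  have fin: "finite B" using B by (simp add: order_basis_def)
  have "\<forall>b\<in>B. \<forall>c\<in>B. \<exists>h. size_le B h (b * c)"
    using B by (auto simp: order_basis_def intro: size_le_span)
  then obtain h where h: "\<And>b c. b \<in> B \<Longrightarrow> c \<in> B \<Longrightarrow> size_le B (h b c) (b * c)"
    by metis
  have h0: "h b c \<ge> 0" if "b \<in> B" "c \<in> B" for b c
    using size_le_nonneg[OF h[OF that]] .
  define C where "C = 1 + (\<Sum>b\<in>B. \<Sum>c\<in>B. h b c)"
  have hC: "h b c \<le> C" if "b \<in> B" "c \<in> B" for b c
  proof -
    have "h b c \<le> (\<Sum>c\<in>B. h b c)"
      using fin h0 that by (intro member_le_sum) auto
    also have "\<dots> \<le> (\<Sum>b\<in>B. \<Sum>c\<in>B. h b c)"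
      using fin h0 that by (intro member_le_sum[of b B "\<lambda>b. \<Sum>c\<in>B. h b c"] sum_nonneg) auto
    finally show ?thesis by (simp add: C_def)
  qed
  have C1: "C \<ge> 1" using h0 by (auto simp: C_def intro!: sum_nonneg)
  have "size_le B (C * H * H') (z * w)" if z: "size_le B H z" and w: "size_le B H' w" for z w H H'
  proof -
    obtain x y where x: "z = (\<Sum>b\<in>B. of_int (x b) * b)" "(\<Sum>b\<in>B. real_of_int \<bar>x b\<bar>) \<le> H"
      and y: "w = (\<Sum>b\<in>B. of_int (y b) * b)" "(\<Sum>b\<in>B. real_of_int \<bar>y b\<bar>) \<le> H'"
      using z w by (auto simp: size_le_def)
    have "z * w = (\<Sum>b\<in>B. \<Sum>c\<in>B. of_int (x b * y c) * (b * c))"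
      unfolding x(1) y(1) sum_product by (intro sum.cong) (auto simp: mult_ac)
    moreover have "size_le B (\<Sum>b\<in>B. \<Sum>c\<in>B. real_of_int \<bar>x b * y c\<bar> * C)
        (\<Sum>b\<in>B. \<Sum>c\<in>B. of_int (x b * y c) * (b * c))"
      by (intro size_le_sum size_le_scale) (auto intro: size_le_mono[OF h hC])
    moreover have "(\<Sum>b\<in>B. \<Sum>c\<in>B. real_of_int \<bar>x b * y c\<bar> * C) \<le> C * H * H'"
    proof -
      have "(\<Sum>b\<in>B. \<Sum>c\<in>B. real_of_int \<bar>x b * y c\<bar> * C) =
          C * ((\<Sum>b\<in>B. real_of_int \<bar>x b\<bar>) * (\<Sum>b\<in>B. real_of_int \<bar>y b\<bar>))"
        unfolding sum_product unfolding sum_distrib_left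
        by (intro sum.cong) (auto simp: abs_mult)
      also have "\<dots> \<le> C * (H * H')"
        using x(2) y(2) C1 size_le_nonneg[OF z] by (intro mult_left_mono mult_mono) (auto intro: sum_nonneg)
      finally show ?thesis by (simp add: mult_ac)
    qed
    ultimately show ?thesis by (auto intro: size_le_mono)
  qed
  then show ?thesis using C1 by blast
qed

text \<open>Multiplying each generator by \<xi> and expanding over \<open>B\<close> gives an integer
  matrix. The vector of all generators is an eigenvector of it for the eigenvalue \<xi>, whichever
  coordinates are chosen.\<close>

lemma order_basis_mult_matrix:
  assumes B: "order_basis B"
  shows "\<exists>C\<ge>1. \<forall>\<xi> H. size_le B H \<xi> \<longrightarrow>
    (\<exists>A :: int mat. A \<in> carrier_mat (card B) (card B) \<and> eigenvalue (map_mat of_int A) \<xi> \<and>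
       (\<forall>i<card B. \<forall>j<card B. real_of_int \<bar>A $$ (i, j)\<bar> \<le> C * H))"
proof -
  have fin: "finite B" and one: "1 \<in> B" using B by (auto simp: order_basis_def)
  obtain C where C: "C \<ge> 1"
    "\<And>z w H H'. size_le B H z \<Longrightarrow> size_le B H' w \<Longrightarrow> size_le B (C * H * H') (z * w)"
    using order_basis_size_mult[OF B] by blast
  define N where "N = card B"
  obtain e where e: "bij_betw e {..<N} B"
    using ex_bij_betw_nat_finite[OF fin] by (auto simp: N_def atLeast0LessThan)
  have "\<exists>A :: int mat. A \<in> carrier_mat N N \<and> eigenvalue (map_mat of_int A) \<xi> \<and>
       (\<forall>i<N. \<forall>j<N. real_of_int \<bar>A $$ (i, j)\<bar> \<le> C * H)" if \<xi>: "size_le B H \<xi>" for \<xi> H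
  proof -
    have "\<forall>b\<in>B. \<exists>y. \<xi> * b = (\<Sum>c\<in>B. of_int (y c) * c) \<and> (\<Sum>c\<in>B. real_of_int \<bar>y c\<bar>) \<le> C * H"
      using C(2)[OF \<xi> size_le_base[OF fin]] unfolding size_le_def by simp
    then obtain y where y: "\<And>b. b \<in> B \<Longrightarrow> \<xi> * b = (\<Sum>c\<in>B. of_int (y b c) * c)"
      "\<And>b. b \<in> B \<Longrightarrow> (\<Sum>c\<in>B. real_of_int \<bar>y b c\<bar>) \<le> C * H" by metis
    define A where "A = mat N N (\<lambda>(i, j). y (e i) (e j))"
    define v where "v = vec N e"
    have eB: "e i \<in> B" if "i < N" for i using e that by (auto simp: bij_betw_def)
    have "real_of_int \<bar>A $$ (i, j)\<bar> \<le> C * H" if "i < N" "j < N" for i j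
    proof -
      have "real_of_int \<bar>y (e i) (e j)\<bar> \<le> (\<Sum>c\<in>B. real_of_int \<bar>y (e i) c\<bar>)"
        using fin eB that by (intro member_le_sum) auto
      then show ?thesis using y(2)[OF eB[OF that(1)]] that by (simp add: A_def)
    qed
    moreover have "eigenvector (map_mat of_int A) v \<xi>"
      unfolding eigenvector_def
    proof (intro conjI)
      \<comment> \<open>The eigenvector is nonzero because one of its entries is the generator
        1.\<close>
      obtain k where k: "k < N" "e k = 1" using e one by (auto simp: bij_betw_def)
      then show "v \<noteq> 0\<^sub>v (dim_row (map_mat complex_of_int A))"
        by (auto simp: v_def A_def dest!: arg_cong[where f = "\<lambda>v. vec_index v k"])
      show "map_mat of_int A *\<^sub>v v = \<xi> \<cdot>\<^sub>v v"
      proof (rule eq_vecI)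
        fix i assume "i < dim_vec (\<xi> \<cdot>\<^sub>v v)"
        then have i: "i < N" by (simp add: v_def)
        have "vec_index (map_mat of_int A *\<^sub>v v) i = (\<Sum>j<N. of_int (y (e i) (e j)) * e j)"
          using i by (simp add: A_def v_def scalar_prod_def atLeast0LessThan)
        also have "\<dots> = (\<Sum>c\<in>B. of_int (y (e i) c) * c)"
          by (rule sum.reindex_bij_betw[OF e])
        also have "\<dots> = \<xi> * e i" using y(1)[OF eB[OF i]] by simp
        finally show "vec_index (map_mat of_int A *\<^sub>v v) i = vec_index (\<xi> \<cdot>\<^sub>v v) i"
          using i by (simp add: v_def)
      qed (simp add: A_def v_def)
    qed (simp add: A_def v_def)
    ultimately show ?thesis
      unfolding eigenvalue_def by (intro exI[of _ A]) (auto simp: A_def)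
  qed
  then show ?thesis using C(1) unfolding N_def by blast
qed

text \<open>A nonzero \<xi> is a nonzero eigenvalue of an integer matrix with entries at most
  \<open>C * H\<close>, so the eigenvalue bound applies with \<open>K = card B * C\<close>.\<close>

lemma order_basis_liouville:
  assumes B: "order_basis B"
  shows "\<exists>K\<ge>1. \<forall>\<xi> H. H \<ge> 1 \<longrightarrow> size_le B H \<xi> \<longrightarrow> \<xi> \<noteq> 0 \<longrightarrow> 1 / (K * H) ^ card B \<le> norm \<xi>"
proof -
  obtain C where C: "C \<ge> 1" "\<And>\<xi> H. size_le B H \<xi> \<Longrightarrow>
    \<exists>A :: int mat. A \<in> carrier_mat (card B) (card B) \<and> eigenvalue (map_mat of_int A) \<xi> \<and>
       (\<forall>i<card B. \<forall>j<card B. real_of_int \<bar>A $$ (i, j)\<bar> \<le> C * H)"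
    using order_basis_mult_matrix[OF B] by blast
  have "card B > 0" using B by (auto simp: order_basis_def card_gt_0_iff)
  then have "1 * 1 \<le> real (card B) * C" using C by (intro mult_mono) auto
  moreover have "1 / (real (card B) * C * H) ^ card B \<le> norm \<xi>"
    if H: "H \<ge> 1" and \<xi>: "size_le B H \<xi>" "\<xi> \<noteq> 0" for \<xi> H
  proof -
    obtain A :: "int mat" where A: "A \<in> carrier_mat (card B) (card B)" "eigenvalue (map_mat of_int A) \<xi>"
       "\<forall>i<card B. \<forall>j<card B. real_of_int \<bar>A $$ (i, j)\<bar> \<le> C * H"
      using C(2)[OF \<xi>(1)] by blast
    have "1 * 1 \<le> C * H" using C H by (intro mult_mono) auto
    then show ?thesis
      using int_mat_eigenvalue_lower_bound[OF A(1,2) \<xi>(2), of "C * H"] A(3) by (simp add: mult.assoc)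
  qed
  ultimately show ?thesis by auto
qed

section \<open>Arithmetic of algebraic numbers\<close>

text \<open>\<xi> is a root of the characteristic polynomial of its integer multiplication matrix,
  which is monic and hence nonzero.\<close>

lemma algebraic_span:
  assumes B: "order_basis B" and \<xi>: "\<xi> \<in> int_mod.span B"
  shows "algebraic \<xi>"
proof -
  obtain H where "size_le B H \<xi>" using size_le_span[OF _ \<xi>] B by (auto simp: order_basis_def)
  then obtain A :: "int mat" where A: "A \<in> carrier_mat (card B) (card B)" "eigenvalue (map_mat of_int A) \<xi>"
    using order_basis_mult_matrix[OF B] by blast
  then have "poly (char_poly (map_mat of_int A)) \<xi> = 0"
    using eigenvalue_root_char_poly[of "map_mat of_int A" "card B" \<xi>] by simp
  then have "poly (map_poly of_int (char_poly A)) \<xi> = 0"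
    using of_int_hom.char_poly_hom[OF A(1), where ?'a = complex] by simp
  moreover have "char_poly A \<noteq> 0" using degree_monic_char_poly[OF A(1)] by auto
  then have "map_poly of_int (char_poly A) \<noteq> (0 :: complex poly)" by simp
  ultimately show ?thesis by (intro algebraicI) auto
qed

text \<open>The product of the individual denominators serves all elements of \<open>A\<close>, and
  the scaled numbers are adjoined to one ring.\<close>

lemma common_order:
  assumes "finite A" "\<And>a. a \<in> A \<Longrightarrow> algebraic a"
  shows "\<exists>B D. order_basis B \<and> D \<noteq> 0 \<and> (\<forall>a\<in>A. of_int D * a \<in> int_mod.span B)"
proof -
  have "\<forall>a\<in>A. \<exists>D. D \<noteq> 0 \<and> integral_over_int (of_int D * a)"
    using assms algebraic_imp_integral_multiple by blast
  then obtain d :: "complex \<Rightarrow> int" where d: "\<And>a. a \<in> A \<Longrightarrow> d a \<noteq> 0" "\<And>a. a \<in> A \<Longrightarrow> integral_over_int (of_int (d a) * a)"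
    by metis
  obtain B where B: "order_basis B" "(\<lambda>a. of_int (d a) * a) ` A \<subseteq> int_mod.span B"
    using order_basis_exists[of "(\<lambda>a. of_int (d a) * a) ` A"] assms d by auto
  have "of_int (\<Prod>a\<in>A. d a) * a \<in> int_mod.span B" if "a \<in> A" for a
  proof -
    have "of_int (\<Prod>a\<in>A - {a}. d a) * (of_int (d a) * a) \<in> int_mod.span B"
      by (rule int_mod.span_scale) (use B that in auto)
    then show ?thesis using assms that by (simp add: prod.remove mult_ac)
  qed
  moreover have "(\<Prod>a\<in>A. d a) \<noteq> 0" using assms d by simp
  ultimately show ?thesis using B(1) by blast
qed

lemma algebraic_of_int_multiple:
  fixes x :: complex
  assumes "algebraic (of_int D * x)" "D \<noteq> 0"
  shows "algebraic x"
proof -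
  obtain p where p: "\<And>i. coeff p i \<in> \<int>" "p \<noteq> 0" "poly p (of_int D * x) = 0"
    using assms(1) by (erule algebraicE)
  show ?thesis
  proof (rule algebraicI)
    show "coeff (pcompose p [:0, of_int D:]) i \<in> \<int>" for i
      using p(1) by (simp add: coeff_pcompose_linear)
    show "pcompose p [:0, of_int D:] \<noteq> 0"
      using pcompose_eq_0[of p "[:0, of_int D:]"] p(2) assms(2) by auto
    show "poly (pcompose p [:0, of_int D:]) x = 0"
      using p(3) by (simp add: poly_pcompose mult.commute)
  qed
qed

text \<open>After scaling by \<open>D\<close> both numbers lie in one ring of algebraic numbers. The
  sum then carries the factor \<open>D\<close> and the product \<open>D * D\<close>, which is
  removed at the end.\<close>

lemma
  fixes x y :: complex
  assumes "algebraic x" "algebraic y"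
  shows algebraic_add: "algebraic (x + y)" and algebraic_mult: "algebraic (x * y)"
proof -
  obtain B D where B: "order_basis B" "D \<noteq> 0" "of_int D * x \<in> int_mod.span B" "of_int D * y \<in> int_mod.span B"
    using common_order[of "{x, y}"] assms by auto
  have "of_int D * x + of_int D * y \<in> int_mod.span B"
    using B by (intro int_mod.span_add)
  then have "of_int D * (x + y) \<in> int_mod.span B" by (simp add: distrib_left)
  then show "algebraic (x + y)"
    using B algebraic_span algebraic_of_int_multiple by blast
  have "(of_int D * x) * (of_int D * y) \<in> int_mod.span B"
    by (rule order_basis_span_mult[OF B(1,3,4)])
  then have "of_int (D * D) * (x * y) \<in> int_mod.span B" by (simp add: mult_ac)
  then show "algebraic (x * y)"
    using B algebraic_span algebraic_of_int_multiple[of "D * D"] by auto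
qed

text \<open>Complete the square: the square of \<open>s = 2 * a * w + b\<close> is the discriminant,
  so \<open>s\<close> is algebraic and \<open>w\<close> is recovered from it. If
  \<open>a = 0\<close>, the equation is linear.\<close>

lemma algebraic_quadratic_root:
  fixes a b c w :: complex
  assumes alg: "algebraic a" "algebraic b" "algebraic c"
    and nz: "a \<noteq> 0 \<or> b \<noteq> 0 \<or> c \<noteq> 0" and eq: "a * w\<^sup>2 + b * w + c = 0"
  shows "algebraic w"
proof (cases "a = 0")
  case False
  define s where "s = 2 * a * w + b"
  have "s\<^sup>2 = b\<^sup>2 + - (4 * a * c) + 4 * a * (a * w\<^sup>2 + b * w + c)"
    by (simp add: s_def power2_eq_square algebra_simps)
  then have s2: "s\<^sup>2 = b * b + - (4 * a * c)" using eq by (simp add: power2_eq_square)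
  have "algebraic (s\<^sup>2)"
    unfolding s2 using alg by (intro algebraic_add algebraic_mult algebraic_minus) auto
  then have "algebraic s"
    by (rule algebraic_root[where p = "monom 1 2"]) (auto simp: poly_monom degree_monom_eq)
  then have "algebraic ((s + - b) * inverse (2 * a))"
    using alg by (intro algebraic_add algebraic_mult algebraic_minus algebraic_inverse) auto
  also have "(s + - b) * inverse (2 * a) = w" using False by (simp add: s_def field_simps)
  finally show ?thesis .
next
  case True
  then have bw: "b * w + c = 0" using eq by simp
  then have "b \<noteq> 0" using nz True by auto
  moreover have "b * w = - c" using bw by (simp add: add_eq_0_iff2)
  ultimately have "w = - c * inverse b" by (simp add: field_simps)
  then show ?thesis using alg by (auto intro: algebraic_mult)
qed

section \<open>Siegel's lemma\<close>

text \<open>Pigeonhole principle: there are more integer vectors in a box than possible values of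
  the linear forms on it, and the difference of two vectors with equal values is a solution.\<close>

lemma siegel_int:
  fixes a :: "'j \<Rightarrow> 'i \<Rightarrow> int" and A :: nat
  assumes I: "finite I" "I \<noteq> {}" and J: "finite J" "2 * card J \<le> card I"
    and A: "A > 0" "\<And>i j. i \<in> I \<Longrightarrow> j \<in> J \<Longrightarrow> \<bar>a j i\<bar> \<le> int A"
  shows "\<exists>p. (\<exists>i\<in>I. p i \<noteq> 0) \<and> (\<forall>i\<in>I. \<bar>p i\<bar> \<le> int (2 * card I * A)) \<and>
           (\<forall>j\<in>J. (\<Sum>i\<in>I. a j i * p i) = 0)"
proof -
  \<comment> \<open>\<open>Y\<close> bounds the forms on the box, and the factor 2 in
    \<open>X\<close> makes \<open>2 * Y = X ^ 2\<close>. Each form thus has at most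
    \<open>X ^ 2 + 1 < (X + 1) ^ 2\<close> values, which two unknowns per form outnumber.\<close>
  define X where "X = 2 * card I * A"
  define Y where "Y = card I * A * X"
  have cI: "card I > 0" using I by (simp add: card_gt_0_iff)
  have X: "X > 0" using cI A by (simp add: X_def)
  have Y: "2 * Y + 1 = X ^ 2 + 1" by (simp add: X_def Y_def power2_eq_square)
  define S where "S = I \<rightarrow>\<^sub>E {0..int X}"
  define T where "T = J \<rightarrow>\<^sub>E {- int Y..int Y}"
  define f where "f x = restrict (\<lambda>j. \<Sum>i\<in>I. a j i * x i) J" for x
  have fST: "f ` S \<subseteq> T"
  proof (clarify)
    fix x assume x: "x \<in> S"
    have "\<bar>\<Sum>i\<in>I. a j i * x i\<bar> \<le> int Y" if "j \<in> J" for j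
    proof -
      have "\<bar>\<Sum>i\<in>I. a j i * x i\<bar> \<le> (\<Sum>i\<in>I. \<bar>a j i * x i\<bar>)" by (rule sum_abs)
      also have "\<dots> \<le> (\<Sum>i\<in>I. int A * int X)"
      proof (rule sum_mono)
        fix i assume i: "i \<in> I"
        have "x i \<in> {0..int X}" using x i by (auto simp: S_def)
        then show "\<bar>a j i * x i\<bar> \<le> int A * int X"
          unfolding abs_mult using A(2)[OF i that] by (intro mult_mono) auto
      qed
      also have "\<dots> = int Y" by (simp add: Y_def)
      finally show ?thesis .
    qed
    then show "f x \<in> T" by (auto simp: f_def T_def abs_le_iff minus_le_iff)
  qed
  have fin: "finite S" "finite T" using I J by (auto simp: S_def T_def intro: finite_PiE)
  have cS: "card S = (X + 1) ^ card I" using I by (simp add: S_def card_PiE nat_add_distrib)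
  have cT: "card T = (X ^ 2 + 1) ^ card J"
  proof -
    have "card {- int Y..int Y} = 2 * Y + 1" by simp
    then show ?thesis using J Y by (simp add: T_def card_PiE)
  qed
  have "card T < card S"
  proof (cases "card J = 0")
    case True
    have "1 < (X + 1) ^ card I" using X cI by (intro one_less_power) auto
    then show ?thesis using True by (simp add: cS cT)
  next
    case False
    have "card T < ((X + 1) ^ 2) ^ card J"
      unfolding cT using X False by (intro power_strict_mono) (auto simp: power2_eq_square)
    also have "\<dots> = (X + 1) ^ (2 * card J)" by (simp add: power_mult)
    also have "\<dots> \<le> card S" unfolding cS using J(2) by (intro power_increasing) auto
    finally show ?thesis .
  qed
  then have "card (f ` S) < card S" using card_mono[OF fin(2) fST] by linarith
  then have "\<not> inj_on f S" by (rule pigeonhole)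
  then obtain x y where xy: "x \<in> S" "y \<in> S" "x \<noteq> y" "f x = f y" by (auto simp: inj_on_def)
  have "\<exists>i\<in>I. x i - y i \<noteq> 0"
  proof (rule ccontr)
    assume "\<not> ?thesis"
    then have "x = y" using xy(1,2) unfolding S_def by (intro PiE_ext[of x I _ y]) auto
    then show False using xy by simp
  qed
  moreover have "\<bar>x i - y i\<bar> \<le> int X" if "i \<in> I" for i
  proof -
    have "x i \<in> {0..int X}" "y i \<in> {0..int X}" using xy that by (auto simp: S_def)
    then show ?thesis by auto
  qed
  moreover have "(\<Sum>i\<in>I. a j i * (x i - y i)) = 0" if "j \<in> J" for j
  proof -
    have "f x j = f y j" using xy by simp
    then show ?thesis using that by (simp add: f_def algebra_simps sum_subtractf)
  qed
  ultimately show ?thesis unfolding X_def by (intro exI[of _ "\<lambda>i. x i - y i"]) auto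
qed

text \<open>Taking coordinates over \<open>B\<close> replaces each equation by \<open>card B\<close>
  integer equations, whence the factor \<open>card B\<close> in the count; solving all of them
  solves the original one.\<close>

lemma siegel_order:
  fixes a :: "'j \<Rightarrow> 'i \<Rightarrow> complex"
  assumes B: "order_basis B" and I: "finite I" "I \<noteq> {}"
    and J: "finite J" "2 * (card J * card B) \<le> card I"
    and A: "A \<ge> 1" "\<And>i j. i \<in> I \<Longrightarrow> j \<in> J \<Longrightarrow> size_le B A (a j i)"
  shows "\<exists>p. (\<exists>i\<in>I. p i \<noteq> 0) \<and> (\<forall>i\<in>I. real_of_int \<bar>p i\<bar> \<le> 2 * real (card I) * A) \<and>
           (\<forall>j\<in>J. (\<Sum>i\<in>I. of_int (p i) * a j i) = 0)"
proof -
  have fin: "finite B" using B by (simp add: order_basis_def)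
  have "\<forall>j\<in>J. \<forall>i\<in>I. \<exists>x. a j i = (\<Sum>b\<in>B. of_int (x b) * b) \<and> (\<Sum>b\<in>B. real_of_int \<bar>x b\<bar>) \<le> A"
    using A(2) unfolding size_le_def by blast
  then obtain x where x: "\<And>j i. j \<in> J \<Longrightarrow> i \<in> I \<Longrightarrow> a j i = (\<Sum>b\<in>B. of_int (x j i b) * b)"
    "\<And>j i. j \<in> J \<Longrightarrow> i \<in> I \<Longrightarrow> (\<Sum>b\<in>B. real_of_int \<bar>x j i b\<bar>) \<le> A" by metis
  have bound: "\<bar>x j i b\<bar> \<le> int (nat \<lfloor>A\<rfloor>)" if "j \<in> J" "i \<in> I" "b \<in> B" for j i b
  proof -
    have "real_of_int \<bar>x j i b\<bar> \<le> (\<Sum>b\<in>B. real_of_int \<bar>x j i b\<bar>)"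
      using fin that by (intro member_le_sum) auto
    then have "real_of_int \<bar>x j i b\<bar> \<le> A" using x(2)[OF that(1,2)] by linarith
    then show ?thesis using A(1) by (simp add: le_floor_iff)
  qed
  have "\<exists>p. (\<exists>i\<in>I. p i \<noteq> 0) \<and> (\<forall>i\<in>I. \<bar>p i\<bar> \<le> int (2 * card I * nat \<lfloor>A\<rfloor>)) \<and>
           (\<forall>jb\<in>J \<times> B. (\<Sum>i\<in>I. x (fst jb) i (snd jb) * p i) = 0)"
  proof (rule siegel_int)
    show "2 * card (J \<times> B) \<le> card I" using J by (simp add: card_cartesian_product)
    show "0 < nat \<lfloor>A\<rfloor>" using A(1) by simp
    show "\<And>i j. i \<in> I \<Longrightarrow> j \<in> J \<times> B \<Longrightarrow> \<bar>x (fst j) i (snd j)\<bar> \<le> int (nat \<lfloor>A\<rfloor>)"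
      using bound by auto
  qed (use I J fin in auto)
  then obtain p where p: "\<exists>i\<in>I. p i \<noteq> 0" "\<And>i. i \<in> I \<Longrightarrow> \<bar>p i\<bar> \<le> int (2 * card I * nat \<lfloor>A\<rfloor>)"
    "\<And>jb. jb \<in> J \<times> B \<Longrightarrow> (\<Sum>i\<in>I. x (fst jb) i (snd jb) * p i) = 0" by blast
  have "real_of_int \<bar>p i\<bar> \<le> 2 * real (card I) * A" if "i \<in> I" for i
  proof -
    have "real_of_int \<bar>p i\<bar> \<le> real_of_int (int (2 * card I * nat \<lfloor>A\<rfloor>))"
      using p(2)[OF that] by (simp only: of_int_le_iff)
    also have "\<dots> = 2 * real (card I) * real (nat \<lfloor>A\<rfloor>)" by simp
    also have "\<dots> \<le> 2 * real (card I) * A" using A(1) by (intro mult_left_mono) (auto simp: of_nat_floor)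
    finally show ?thesis .
  qed
  moreover have "(\<Sum>i\<in>I. of_int (p i) * a j i) = 0" if "j \<in> J" for j
  proof -
    have "(\<Sum>i\<in>I. of_int (p i) * a j i) = (\<Sum>i\<in>I. \<Sum>b\<in>B. of_int (x j i b * p i) * b)"
      using x(1)[OF that] by (intro sum.cong) (auto simp: sum_distrib_left mult_ac)
    also have "\<dots> = (\<Sum>b\<in>B. of_int (\<Sum>i\<in>I. x j i b * p i) * b)"
      by (subst sum.swap) (simp add: sum_distrib_right)
    also have "\<dots> = 0" using p(3)[of "(j, _)"] that by simp
    finally show ?thesis .
  qed
  ultimately show ?thesis using p(1) by blast
qed

section \<open>Entire functions with many zeros\<close>

text \<open>If all power sums vanished, so would the sum of \<open>p i * poly q (w i)\<close> for
  every polynomial \<open>q\<close>. A \<open>q\<close> vanishing at all nodes except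
  \<open>w i0\<close> isolates \<open>p i0\<close>.\<close>

lemma power_sum_nonzero:
  fixes w :: "'i \<Rightarrow> 'a::field"
  assumes I: "finite I" "inj_on w I" and i0: "i0 \<in> I" "p i0 \<noteq> 0"
  shows "\<exists>k. (\<Sum>i\<in>I. p i * w i ^ k) \<noteq> 0"
proof (rule ccontr)
  assume "\<not> ?thesis"
  then have z: "(\<Sum>i\<in>I. p i * w i ^ k) = 0" for k by blast
  define q where "q = (\<Prod>i\<in>I - {i0}. [:- w i, 1:])"
  have "(\<Sum>i\<in>I. p i * poly q (w i)) = (\<Sum>k\<le>degree q. coeff q k * (\<Sum>i\<in>I. p i * w i ^ k))"
    unfolding poly_altdef sum_distrib_left by (subst sum.swap) (simp add: mult_ac)
  also have "\<dots> = 0" by (simp add: z)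
  also have "(\<Sum>i\<in>I. p i * poly q (w i)) = p i0 * poly q (w i0)"
  proof -
    have "poly q (w i) = 0" if "i \<in> I - {i0}" for i
      unfolding q_def poly_prod using I that by (intro prod_zero) auto
    then show ?thesis using I i0 by (simp add: sum.remove)
  qed
  finally have "poly q (w i0) = 0" using i0 by simp
  then show False using I i0 by (auto simp: q_def poly_prod inj_on_def)
qed

lemma higher_deriv_exp_sum:
  fixes p w :: "'i \<Rightarrow> complex"
  shows "(deriv ^^ k) (\<lambda>z. \<Sum>i\<in>I. p i * exp (w i * z)) = (\<lambda>z. \<Sum>i\<in>I. p i * w i ^ k * exp (w i * z))"
proof (induction k)
  case 0
  then show ?case by simp
next
  case (Suc k)
  show ?case
    unfolding funpow.simps comp_def Suc
    by (rule ext, rule DERIV_imp_deriv) (auto intro!: derivative_eq_intros sum.cong simp: mult_ac)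
qed

lemma entire_divide_zero:
  assumes "f holomorphic_on UNIV" "f a = 0"
  shows "\<exists>g. g holomorphic_on UNIV \<and> (\<forall>z. f z = (z - a) * g z)"
proof -
  define g where "g z = (if z = a then deriv f a else f z / (z - a))" for z
  have "g holomorphic_on UNIV"
    by (rule pole_theorem_open_0[OF assms(1), of a]) (auto simp: g_def assms)
  then show ?thesis using assms by (intro exI[of _ g]) (auto simp: g_def)
qed

text \<open>In the Leibniz formula at \<open>a\<close> only the term in which all \<open>k\<close>
  derivatives fall on the power survives.\<close>

lemma higher_deriv_power_times:
  assumes g: "g holomorphic_on UNIV" and f: "\<And>z. f z = (z - a) ^ k * g z"
  shows "(deriv ^^ k) f a = fact k * g a"
proof -
  have "(deriv ^^ k) f a = (deriv ^^ k) (\<lambda>z. (z - a) ^ k * g z) a"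
    using f by presburger
  also have "\<dots> = (\<Sum>i = 0..k. of_nat (k choose i) * (deriv ^^ i) (\<lambda>z. (z - a) ^ k) a * (deriv ^^ (k - i)) g a)"
    by (rule higher_deriv_mult[of _ UNIV]) (auto intro!: holomorphic_intros g)
  also have "\<dots> = (\<Sum>i = 0..k. if i = k then fact k * g a else 0)"
    by (rule sum.cong) (auto simp: higher_deriv_power pochhammer_fact)
  also have "\<dots> = fact k * g a" by simp
  finally show ?thesis .
qed

text \<open>The points are treated one at a time, and at each point one linear factor is split off
  at a time.\<close>

lemma entire_divide_zeros:
  assumes f: "f holomorphic_on UNIV" and Z: "finite Z"
    and zero: "\<And>a k. a \<in> Z \<Longrightarrow> k < T \<Longrightarrow> (deriv ^^ k) f a = 0"
  shows "\<exists>g. g holomorphic_on UNIV \<and> (\<forall>z. f z = (\<Prod>a\<in>Z. (z - a) ^ T) * g z)"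
  using Z zero
proof (induction Z rule: finite_induct)
  case empty
  then show ?case using f by auto
next
  case (insert a Z)
  then obtain g where g: "g holomorphic_on UNIV" "\<And>z. f z = (\<Prod>a\<in>Z. (z - a) ^ T) * g z"
    by auto
  have "\<exists>h. h holomorphic_on UNIV \<and> (\<forall>z. g z = (z - a) ^ k * h z)" if "k \<le> T" for k
    using that
  proof (induction k)
    case 0
    then show ?case using g by auto
  next
    case (Suc k)
    then obtain h where h: "h holomorphic_on UNIV" "\<And>z. g z = (z - a) ^ k * h z" by auto
    \<comment> \<open>Here \<open>f\<close> is \<open>(z - a) ^ k\<close> times the product over the
      earlier zeros times \<open>h\<close>, so the vanishing derivative forces
      \<open>h a = 0\<close>.\<close>
    have "(deriv ^^ k) f a = fact k * ((\<Prod>b\<in>Z. (a - b) ^ T) * h a)"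
      by (rule higher_deriv_power_times) (auto intro!: holomorphic_intros h(1) simp: g(2) h(2))
    moreover have "(\<Prod>b\<in>Z. (a - b) ^ T) \<noteq> 0" using insert.hyps by auto
    ultimately have "h a = 0" using insert.prems[of a k] Suc.prems by auto
    then obtain h' where "h' holomorphic_on UNIV" "\<And>z. h z = (z - a) * h' z"
      using entire_divide_zero h(1) by blast
    then show ?case using h(2) by (intro exI[of _ h']) auto
  qed
  then obtain h where "h holomorphic_on UNIV" "\<And>z. g z = (z - a) ^ T * h z" by blast
  then show ?case using insert.hyps g(2) by (intro exI[of _ h]) auto
qed

text \<open>Divide \<open>f\<close> by all its zeros. The derivative at \<open>a\<close> is
  \<open>fact T\<close> times the factors of the other zeros times the quotient at \<open>a\<close>,
  and the maximum principle bounds the quotient, because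
  \<open>norm (z - b) \<ge> R - \<rho>\<close> on the circle.\<close>

lemma higher_deriv_bound_many_zeros:
  assumes f: "f holomorphic_on UNIV" and Z: "finite Z" "a \<in> Z"
    and zero: "\<And>b k. b \<in> Z \<Longrightarrow> k < T \<Longrightarrow> (deriv ^^ k) f b = 0"
    and \<rho>: "\<rho> \<ge> 1" "\<And>b. b \<in> Z \<Longrightarrow> norm b \<le> \<rho>" "\<rho> < R"
    and bound: "\<And>z. norm z = R \<Longrightarrow> norm (f z) \<le> K"
  shows "norm ((deriv ^^ T) f a) \<le> fact T * (2 * \<rho>) ^ (T * card Z) * (K / (R - \<rho>) ^ (T * card Z))"
proof -
  obtain g where g: "g holomorphic_on UNIV" "\<And>z. f z = (\<Prod>a\<in>Z. (z - a) ^ T) * g z"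
    using entire_divide_zeros[OF f Z(1) zero] by blast
  have "(deriv ^^ T) f a = fact T * ((\<Prod>b\<in>Z - {a}. (a - b) ^ T) * g a)"
    by (rule higher_deriv_power_times)
      (auto intro!: holomorphic_intros g(1) simp: g(2) prod.remove[OF Z])
  then have 1: "norm ((deriv ^^ T) f a) = fact T * (norm (\<Prod>b\<in>Z - {a}. (a - b) ^ T) * norm (g a))"
    by (simp add: norm_mult)
  have "norm (\<Prod>b\<in>Z - {a}. (a - b) ^ T) \<le> (\<Prod>b\<in>Z - {a}. (2 * \<rho>) ^ T)"
    unfolding prod_norm[symmetric]
  proof (intro prod_mono conjI)
    fix b assume "b \<in> Z - {a}"
    then have "norm (a - b) \<le> 2 * \<rho>"
      using norm_triangle_ineq4[of a b] \<rho>(2)[of a] \<rho>(2)[of b] Z by auto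
    then show "norm ((a - b) ^ T) \<le> (2 * \<rho>) ^ T" unfolding norm_power by (intro power_mono) auto
  qed auto
  also have "\<dots> = (2 * \<rho>) ^ (T * card (Z - {a}))" by (simp add: power_mult)
  \<comment> \<open>Since \<open>2 * \<rho> \<ge> 1\<close>, the factor missing for \<open>a\<close>
    may be put back.\<close>
  also have "\<dots> \<le> (2 * \<rho>) ^ (T * card Z)"
    using \<rho> Z by (intro power_increasing mult_left_mono card_mono) auto
  finally have 2: "norm (\<Prod>b\<in>Z - {a}. (a - b) ^ T) \<le> (2 * \<rho>) ^ (T * card Z)" .
  have 3: "norm (g a) \<le> K / (R - \<rho>) ^ (T * card Z)"
  proof (rule maximum_modulus_frontier[of g "cball 0 R"])
    show "g holomorphic_on interior (cball 0 R)" "continuous_on (closure (cball 0 R)) g"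
      using g(1) by (auto intro: holomorphic_on_subset holomorphic_on_imp_continuous_on)
    show "a \<in> cball 0 R" using \<rho>(2)[OF Z(2)] \<rho>(3) by simp
    fix z assume "z \<in> frontier (cball (0::complex) R)"
    then have z: "norm z = R" using \<rho> by (simp add: frontier_cball)
    have "(\<Prod>b\<in>Z. (R - \<rho>) ^ T) \<le> norm (\<Prod>b\<in>Z. (z - b) ^ T)"
      unfolding prod_norm[symmetric]
    proof (intro prod_mono conjI)
      fix b assume "b \<in> Z"
      then have "R - \<rho> \<le> norm (z - b)" using norm_triangle_ineq2[of z b] \<rho>(2)[of b] z by auto
      then show "(R - \<rho>) ^ T \<le> norm ((z - b) ^ T)"
        using \<rho> unfolding norm_power by (intro power_mono) auto
    qed (use \<rho> in auto)
    then have "(R - \<rho>) ^ (T * card Z) * norm (g z) \<le> norm (f z)"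
      by (simp add: g(2) norm_mult power_mult mult_right_mono)
    also have "\<dots> \<le> K" by (rule bound[OF z])
    finally show "norm (g z) \<le> K / (R - \<rho>) ^ (T * card Z)"
      using \<rho> by (simp add: field_simps)
  qed auto
  have "norm (\<Prod>b\<in>Z - {a}. (a - b) ^ T) * norm (g a) \<le>
      (2 * \<rho>) ^ (T * card Z) * (K / (R - \<rho>) ^ (T * card Z))"
    by (intro mult_mono 2 3) (use \<rho> in auto)
  then show ?thesis unfolding 1 mult.assoc by (rule mult_left_mono) auto
qed

section \<open>The Gelfond--Schneider theorem\<close>

text \<open>A bound for the size of the algebraic integers
  \<open>D ^ (k + 2 * q * M) * (i + j * b) ^ k * (\<alpha> ^ i * \<gamma> ^ j) ^ m\<close> with \<open>i, j < q\<close> and \<open>m < M\<close>,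
  which are the coefficients of the linear conditions on the auxiliary function.\<close>

definition gelfond_bound :: "real \<Rightarrow> nat \<Rightarrow> nat \<Rightarrow> nat \<Rightarrow> real" where
  "gelfond_bound s q M k = s * (2 * real q * s) ^ k * s ^ (2 * q * M)"

lemma gelfond_bound_ge_1:
  assumes "s \<ge> 1" "q > 0"
  shows "gelfond_bound s q M k \<ge> 1"
proof -
  have "1 * 1 \<le> 2 * real q * s" using assms by (intro mult_mono) auto
  then have "1 * 1 * 1 \<le> gelfond_bound s q M k"
    unfolding gelfond_bound_def using assms by (intro mult_mono one_le_power) auto
  then show ?thesis by simp
qed

text \<open>With \<open>l\<close> a logarithm of \<alpha>, the exponential is \<alpha> to the power
  \<open>(i + j * b) * z\<close>. At natural numbers the \<open>k\<close>-th derivative is therefore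
  \<open>l ^ k\<close> times an integer polynomial expression in \<open>b\<close>, \<alpha> and
  \<gamma>.\<close>

definition gelfond_fun :: "nat \<Rightarrow> (nat \<times> nat \<Rightarrow> int) \<Rightarrow> complex \<Rightarrow> complex \<Rightarrow> complex \<Rightarrow> complex" where
  "gelfond_fun q p b l z =
     (\<Sum>(i, j)\<in>{..<q} \<times> {..<q}. of_int (p (i, j)) * exp ((of_nat i + of_nat j * b) * l * z))"

text \<open>The power of \<open>D\<close> clears the denominators of all factors and depends only on
  \<open>k\<close>, \<open>q\<close> and \<open>M\<close>, so that it can be taken out of a sum over
  \<open>i\<close> and \<open>j\<close>.\<close>

lemma gelfond_coefficient_size:
  fixes b \<alpha> \<gamma> :: complex and D :: int
  assumes B: "order_basis B"
    and mem: "of_int D * b \<in> int_mod.span B" "of_int D * \<alpha> \<in> int_mod.span B" "of_int D * \<gamma> \<in> int_mod.span B"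
  shows "\<exists>s\<ge>1. \<forall>q M k m i j. i < q \<longrightarrow> j < q \<longrightarrow> m < M \<longrightarrow>
    size_le B (gelfond_bound s q M k)
      (of_int D ^ (k + 2 * q * M) * ((of_nat i + of_nat j * b) ^ k * (\<alpha> ^ i * \<gamma> ^ j) ^ m))"
proof -
  have fin: "finite B" and one: "1 \<in> B" using B by (auto simp: order_basis_def)
  obtain C where C: "C \<ge> 1"
    "\<And>z w H H'. size_le B H z \<Longrightarrow> size_le B H' w \<Longrightarrow> size_le B (C * H * H') (z * w)"
    using order_basis_size_mult[OF B] by blast
  \<comment> \<open>Dividing by \<open>C\<close> makes the size bound submultiplicative without a
    constant.\<close>
  define sz where "sz H z = size_le B (H / C) z" for H z
  have sz_mult: "sz (H * H') (z * w)" if "sz H z" "sz H' w" for H H' z w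
    using C(2)[OF that[unfolded sz_def]] C(1) by (simp add: sz_def)
  have sz_mono: "sz H' z" if "sz H z" "H \<le> H'" for H H' z
    using that C(1) by (auto simp: sz_def intro!: size_le_mono[of B "H / C"] divide_right_mono)
  have sz_one: "sz C 1" using size_le_base[OF fin one] C(1) by (simp add: sz_def)
  have sz_power: "sz (C * H ^ k) (z ^ k)" if "sz H z" for H z k
  proof (induction k)
    case 0
    then show ?case using sz_one by simp
  next
    case (Suc k)
    then show ?case using sz_mult[OF that Suc] by (simp add: mult_ac)
  qed
  have sz_ex: "\<exists>h. sz h z" if "z \<in> int_mod.span B" for z
  proof -
    obtain h where "size_le B h z" using size_le_span[OF fin \<open>z \<in> int_mod.span B\<close>] by blast
    then have "sz (C * h) z" using C(1) by (simp add: sz_def)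
    then show ?thesis by blast
  qed
  obtain h1 h2 h3 h4 where h: "sz h1 (of_int D)" "sz h2 (of_int D * b)" "sz h3 (of_int D * \<alpha>)" "sz h4 (of_int D * \<gamma>)"
    using sz_ex[OF order_basis_span_of_int[OF B]] sz_ex[OF mem(1)] sz_ex[OF mem(2)] sz_ex[OF mem(3)] by blast
  \<comment> \<open>\<open>C ^ 4\<close> pays for the four uses of \<open>sz_power\<close> below;
    the other summands dominate the four basic sizes.\<close>
  define s where "s = C ^ 4 + \<bar>h1\<bar> + \<bar>h2\<bar> + \<bar>h3\<bar> + \<bar>h4\<bar>"
  have C4: "C ^ 4 \<ge> 1" using C(1) by (simp add: one_le_power)
  then have s: "s \<ge> 1" "C ^ 4 \<le> s" by (auto simp: s_def)
  have S: "sz s (of_int D)" "sz s (of_int D * b)" "sz s (of_int D * \<alpha>)" "sz s (of_int D * \<gamma>)"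
    using C4 by (auto intro!: sz_mono[OF h(1)] sz_mono[OF h(2)] sz_mono[OF h(3)] sz_mono[OF h(4)] simp: s_def)
  have "size_le B (gelfond_bound s q M k)
      (of_int D ^ (k + 2 * q * M) * ((of_nat i + of_nat j * b) ^ k * (\<alpha> ^ i * \<gamma> ^ j) ^ m))"
    if ij: "i < q" "j < q" "m < M" for q M k m i j :: nat
  proof -
    \<comment> \<open>\<open>e\<close> is the power of \<open>D\<close> left over after clearing the
      denominators of \<alpha> and \<gamma>.\<close>
    have "i * m \<le> q * M" "j * m \<le> q * M" using ij by (auto intro!: mult_mono)
    then obtain e where e: "2 * q * M = i * m + (j * m + e)"
      using le_Suc_ex[of "i * m + j * m" "2 * q * M"] by (auto simp: add.assoc)
    have lin: "sz (2 * real q * s) (of_int D * (of_nat i + of_nat j * b))"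
    proof -
      have "size_le B (real_of_int \<bar>int i\<bar> * (s / C) + real_of_int \<bar>int j\<bar> * (s / C))
          (of_int (int i) * of_int D + of_int (int j) * (of_int D * b))"
        using S by (intro size_le_add size_le_scale) (auto simp: sz_def)
      then have "sz ((real i + real j) * s) (of_int D * (of_nat i + of_nat j * b))"
        by (simp add: sz_def algebra_simps add_divide_distrib)
      then show ?thesis
      proof (rule sz_mono)
        show "(real i + real j) * s \<le> 2 * real q * s" using ij s by (intro mult_right_mono) auto
      qed
    qed
    have "of_int D ^ (k + 2 * q * M) * ((of_nat i + of_nat j * b) ^ k * (\<alpha> ^ i * \<gamma> ^ j) ^ m) =
        (of_int D * (of_nat i + of_nat j * b)) ^ k *
        ((of_int D * \<alpha>) ^ (i * m) * ((of_int D * \<gamma>) ^ (j * m) * of_int D ^ e))"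
      unfolding e by (simp add: power_add power_mult power_mult_distrib)
    moreover have "sz (C * (2 * real q * s) ^ k * (C * s ^ (i * m) * (C * s ^ (j * m) * (C * s ^ e)))) \<dots>"
      by (intro sz_mult sz_power lin S)
    moreover have "C * (2 * real q * s) ^ k * (C * s ^ (i * m) * (C * s ^ (j * m) * (C * s ^ e))) =
        C ^ 4 * ((2 * real q * s) ^ k * s ^ (2 * q * M))"
      unfolding e by (simp add: power_add power4_eq_xxxx)
    ultimately have "size_le B (C ^ 4 * ((2 * real q * s) ^ k * s ^ (2 * q * M)) / C)
        (of_int D ^ (k + 2 * q * M) * ((of_nat i + of_nat j * b) ^ k * (\<alpha> ^ i * \<gamma> ^ j) ^ m))"
      unfolding sz_def by simp
    then show ?thesis
    proof (rule size_le_mono)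
      let ?X = "(2 * real q * s) ^ k * s ^ (2 * q * M)"
      have X: "?X \<ge> 0" using s by simp
      have "C ^ 4 * ?X / C \<le> C ^ 4 * ?X / 1" using C(1) X by (intro divide_left_mono) auto
      also have "\<dots> \<le> s * ?X" using s(2) X by (simp add: mult_right_mono)
      finally show "C ^ 4 * ?X / C \<le> gelfond_bound s q M k" by (simp add: gelfond_bound_def mult.assoc)
    qed
  qed
  then show ?thesis using s(1) by blast
qed

lemma gelfond_auxiliary_function:
  fixes l b :: complex and t :: nat
  assumes B: "order_basis B" and N: "N = card B" and M: "M > 0" and t: "t > 0"
    and q: "q = 2 * M * N * t" and n: "n = 2 * M * N * t\<^sup>2"
    and b: "b \<notin> \<rat>" and D: "D \<noteq> 0" and s: "s \<ge> 1"
    and size: "\<And>k m i j. i < q \<Longrightarrow> j < q \<Longrightarrow> m < M \<Longrightarrow>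
      size_le B (gelfond_bound s q M k)
        (of_int D ^ (k + 2 * q * M) * ((of_nat i + of_nat j * b) ^ k * (exp l ^ i * exp (b * l) ^ j) ^ m))"
  shows "\<exists>p T m0 V. n \<le> T \<and> m0 < M \<and> V \<noteq> 0 \<and>
    (\<forall>i<q. \<forall>j<q. real_of_int \<bar>p (i, j)\<bar> \<le> 2 * real (q\<^sup>2) * gelfond_bound s q M n) \<and>
    (\<forall>k<T. \<forall>m<M. (deriv ^^ k) (gelfond_fun q p b l) (of_nat m) = 0) \<and>
    (deriv ^^ T) (gelfond_fun q p b l) (of_nat m0) = l ^ T * V \<and>
    size_le B (real (q\<^sup>2) * (2 * real (q\<^sup>2) * gelfond_bound s q M n) * gelfond_bound s q M T)
      (of_int D ^ (T + 2 * q * M) * V)"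
proof -
  have N0: "N > 0" using B by (auto simp: N order_basis_def card_gt_0_iff)
  define I where "I = {..<q} \<times> {..<q}"
  define J where "J = {..<n} \<times> {..<M}"
  define w where "w = (\<lambda>(i, j). of_nat i + of_nat j * b :: complex)"
  define v where "v = (\<lambda>(i, j). exp l ^ i * exp (b * l) ^ j :: complex)"
  define A where "A = gelfond_bound s q M"
  have q0: "q > 0" using M N0 t by (simp add: q)
  have "1 * 1 \<le> 2 * real q * s" using q0 s by (intro mult_mono) auto
  then have qs: "2 * real q * s \<ge> 1" by simp
  have A1: "A k \<ge> 1" for k using gelfond_bound_ge_1[OF s q0] by (simp add: A_def)
  have Amono: "A j \<le> A k" if "j \<le> k" for j k
    unfolding A_def gelfond_bound_def using s qs that by (intro mult_mono power_increasing mult_nonneg_nonneg) auto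
  have fin: "finite I" "finite J" and cI: "card I = q\<^sup>2"
    by (auto simp: I_def J_def power2_eq_square)
  have I0: "I \<noteq> {}" using q0 by (auto simp: I_def)
  have size': "size_le B (A k) (of_int D ^ (k + 2 * q * M) * (w x ^ k * v x ^ m))" if "x \<in> I" "m < M" for x k m
    using size[of "fst x" "snd x" m k] that by (auto simp: A_def I_def w_def v_def)
  have "\<exists>p. (\<exists>i\<in>I. p i \<noteq> 0) \<and> (\<forall>i\<in>I. real_of_int \<bar>p i\<bar> \<le> 2 * real (card I) * A n) \<and>
      (\<forall>km\<in>J. (\<Sum>x\<in>I. of_int (p x) * (of_int D ^ (fst km + 2 * q * M) * (w x ^ fst km * v x ^ snd km))) = 0)"
  proof (rule siegel_order[OF B fin(1) I0 fin(2)])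
    \<comment> \<open>The choice of \<open>q\<close> and \<open>n\<close> gives exactly twice as
      many unknowns as integer equations.\<close>
    have "2 * (card J * N) = q\<^sup>2" by (simp add: J_def q n power2_eq_square)
    then show "2 * (card J * card B) \<le> card I" unfolding N[symmetric] cI by simp
    show "A n \<ge> 1" by (rule A1)
    fix x km assume x: "x \<in> I" and "km \<in> J"
    then have "fst km \<le> n" "snd km < M" by (auto simp: J_def)
    then show "size_le B (A n) (of_int D ^ (fst km + 2 * q * M) * (w x ^ fst km * v x ^ snd km))"
      using size_le_mono[OF size'[OF x] Amono] by blast
  qed
  then obtain p where p: "\<exists>i\<in>I. p i \<noteq> 0" "\<And>i. i \<in> I \<Longrightarrow> real_of_int \<bar>p i\<bar> \<le> 2 * real (q\<^sup>2) * A n"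
    "\<And>km. km \<in> J \<Longrightarrow> (\<Sum>x\<in>I. of_int (p x) * (of_int D ^ (fst km + 2 * q * M) * (w x ^ fst km * v x ^ snd km))) = 0"
    unfolding cI by blast
  define V where "V k m = (\<Sum>x\<in>I. of_int (p x) * (w x ^ k * v x ^ m))" for k m
  define F where "F = gelfond_fun q p b l"
  have DV: "(\<Sum>x\<in>I. of_int (p x) * (of_int D ^ e * (w x ^ k * v x ^ m))) = of_int D ^ e * V k m" for e k m
    by (simp add: V_def sum_distrib_left mult_ac)
  have V0: "V k m = 0" if "k < n" "m < M" for k m
    using p(3)[of "(k, m)"] that D unfolding DV by (simp add: J_def)
  have exp_v: "exp (w x * l * of_nat m) = v x ^ m" for x m
  proof -
    have "exp (of_nat i * l + of_nat j * (b * l)) = exp l ^ i * exp (b * l) ^ j" for i j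
      by (simp add: exp_add exp_of_nat_mult)
    then have "exp (w x * l) = v x" by (auto simp: w_def v_def algebra_simps split: prod.splits)
    then show ?thesis by (metis exp_of_nat2_mult)
  qed
  have F_eq: "F = (\<lambda>z. \<Sum>x\<in>I. of_int (p x) * exp (w x * l * z))"
    unfolding F_def gelfond_fun_def w_def I_def by (intro ext sum.cong) auto
  have derivF: "(deriv ^^ k) F (of_nat m) = l ^ k * V k m" for k m
    unfolding F_eq higher_deriv_exp_sum V_def sum_distrib_left
    by (intro sum.cong) (auto simp: exp_v power_mult_distrib)
  \<comment> \<open>Two equal frequencies with different \<open>j\<close> would exhibit
    \<open>b\<close> as a quotient of integers.\<close>
  have "inj_on w I"
  proof (rule inj_onI)
    fix x y assume "x \<in> I" "y \<in> I" and eq: "w x = w y"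
    obtain i j i' j' where xy: "x = (i, j)" "y = (i', j')" by (cases x, cases y) auto
    have e: "of_int (int i - int i') = of_int (int j' - int j) * b"
      using eq by (simp add: w_def xy algebra_simps)
    have "j = j'"
    proof (rule ccontr)
      assume "j \<noteq> j'"
      then have "b = of_int (int i - int i') / of_int (int j' - int j)"
        using e by (simp add: field_simps)
      then have "b \<in> \<rat>" by simp
      then show False using b by simp
    qed
    then show "x = y" using e by (simp add: xy)
  qed
  then obtain k where "(\<Sum>x\<in>I. of_int (p x) * w x ^ k) \<noteq> 0"
    using power_sum_nonzero[OF fin(1), of w _ "\<lambda>x. of_int (p x)"] p(1) by auto
  \<comment> \<open>At the point 0 every \<open>v x ^ 0\<close> is 1, so \<open>V k 0\<close> is the
    power sum just obtained.\<close>
  then have "V k 0 \<noteq> 0" by (simp add: V_def)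
  then have ex: "\<exists>k. \<exists>m<M. V k m \<noteq> 0" using M by blast
  define T where "T = (LEAST k. \<exists>m<M. V k m \<noteq> 0)"
  obtain m0 where m0: "m0 < M" "V T m0 \<noteq> 0" using LeastI_ex[OF ex] unfolding T_def by blast
  have minT: "V k m = 0" if "k < T" "m < M" for k m
    using not_less_Least[of k "\<lambda>k. \<exists>m<M. V k m \<noteq> 0"] that unfolding T_def by blast
  have nT: "n \<le> T" using V0 m0 by (meson not_le)
  have "size_le B (\<Sum>x\<in>I. real_of_int \<bar>p x\<bar> * A T) (of_int D ^ (T + 2 * q * M) * V T m0)"
    unfolding DV[symmetric] by (intro size_le_sum size_le_scale size' m0)
  moreover have "(\<Sum>x\<in>I. real_of_int \<bar>p x\<bar> * A T) \<le> (\<Sum>x\<in>I. 2 * real (q\<^sup>2) * A n * A T)"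
    using A1[of T] by (intro sum_mono mult_right_mono p) auto
  ultimately have "size_le B (real (q\<^sup>2) * (2 * real (q\<^sup>2) * A n) * A T) (of_int D ^ (T + 2 * q * M) * V T m0)"
    by (auto intro: size_le_mono simp: cI mult.assoc)
  moreover have "\<forall>i<q. \<forall>j<q. real_of_int \<bar>p (i, j)\<bar> \<le> 2 * real (q\<^sup>2) * A n"
    using p(2) by (auto simp: I_def)
  moreover have "\<forall>k<T. \<forall>m<M. (deriv ^^ k) F (of_nat m) = 0"
    using minT by (simp add: derivF)
  ultimately show ?thesis
    unfolding A_def[symmetric]
    using nT m0 derivF[of T m0] unfolding F_def
    by (intro exI[of _ p] exI[of _ T] exI[of _ m0] exI[of _ "V T m0"] conjI)
qed

section \<open>Estimates and the final contradiction\<close>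

text \<open>Every factor is absorbed in a \<open>T\<close>-th power, so that in the end only
  \<open>T\<close>-th roots have to be compared. In the application \<open>r\<close> is
  \<open>sqrt T\<close>.\<close>

lemma gelfond_bound_le:
  assumes s: "s \<ge> 1" and q: "q > 0" "q \<le> T" "real q \<le> g * r" and k: "k \<le> T"
  shows "gelfond_bound s q M k \<le> (2 * g * s ^ (2 * M + 2) * r) ^ T"
proof -
  have "1 * 1 \<le> 2 * real q * s" using q s by (intro mult_mono) auto
  then have qs: "2 * real q * s \<ge> 1" by simp
  have "2 * real q * s \<le> 2 * (g * r) * s" using q s by (intro mult_right_mono) auto
  then have nn: "0 \<le> (2 * (g * r) * s) ^ T" using qs by (intro zero_le_power) linarith
  have "T > 0" using q by simp
  have "s \<le> s ^ T" using s \<open>T > 0\<close> by (simp add: self_le_power)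
  moreover have "(2 * real q * s) ^ k \<le> (2 * (g * r) * s) ^ T"
  proof -
    have "(2 * real q * s) ^ k \<le> (2 * real q * s) ^ T" using qs k by (intro power_increasing)
    also have "\<dots> \<le> (2 * (g * r) * s) ^ T" using q s by (intro power_mono) auto
    finally show ?thesis .
  qed
  moreover have "s ^ (2 * q * M) \<le> s ^ (2 * M * T)"
    using s q by (intro power_increasing) (auto simp: mult_ac)
  ultimately have "gelfond_bound s q M k \<le> s ^ T * (2 * (g * r) * s) ^ T * s ^ (2 * M * T)"
    unfolding gelfond_bound_def using s qs nn by (intro mult_mono) auto
  also have "\<dots> = (s * (2 * (g * r) * s) * s ^ (2 * M)) ^ T"
    by (simp only: power_mult_distrib power_mult)
  also have "s * (2 * (g * r) * s) * s ^ (2 * M) = 2 * g * s ^ (2 * M + 2) * r"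
    by (simp add: power_add power2_eq_square)
  finally show ?thesis .
qed

lemma gelfond_fun_norm_le:
  assumes p: "\<And>i j. i < q \<Longrightarrow> j < q \<Longrightarrow> real_of_int \<bar>p (i, j)\<bar> \<le> P" and "P \<ge> 0"
  shows "norm (gelfond_fun q p b l z) \<le> real (q\<^sup>2) * (P * exp (real q * (1 + norm b) * norm l * norm z))"
proof -
  let ?E = "exp (real q * (1 + norm b) * norm l * norm z)"
  have "norm (gelfond_fun q p b l z) \<le> (\<Sum>x\<in>{..<q} \<times> {..<q}. P * ?E)"
    unfolding gelfond_fun_def
  proof (rule sum_norm_le)
    fix x assume "x \<in> {..<q} \<times> {..<q}"
    then obtain i j where x: "x = (i, j)" "i < q" "j < q" by auto
    let ?w = "of_nat i + of_nat j * b"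
    have "norm ?w \<le> real i + real j * norm b"
      using norm_triangle_ineq[of "of_nat i" "of_nat j * b"] by (simp add: norm_mult)
    also have "\<dots> \<le> real q + real q * norm b"
      using x by (intro add_mono mult_right_mono) auto
    finally have "norm ?w \<le> real q * (1 + norm b)" by (simp add: algebra_simps)
    then have "norm (?w * l * z) \<le> real q * (1 + norm b) * norm l * norm z"
      unfolding norm_mult by (intro mult_right_mono) auto
    then have "norm (exp (?w * l * z)) \<le> ?E"
      using norm_exp[of "?w * l * z"] by (meson exp_le_cancel_iff order_trans)
    then have "norm (of_int (p (i, j)) * exp (?w * l * z)) \<le> P * ?E"
      unfolding norm_mult using p[OF x(2,3)] \<open>P \<ge> 0\<close> by (intro mult_mono) auto
    then show "norm (case x of (i, j) \<Rightarrow> of_int (p (i, j)) * exp ((of_nat i + of_nat j * b) * l * z)) \<le> P * ?E"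
      by (simp add: x)
  qed
  also have "\<dots> = real (q\<^sup>2) * (P * ?E)" by (simp add: power2_eq_square)
  finally show ?thesis .
qed

text \<open>The logarithm \<open>l\<close> is a parameter, so every branch is covered, including
  nonzero logarithms of 1.\<close>

theorem gelfond_schneider:
  fixes l b :: complex
  assumes l: "l \<noteq> 0" and alg: "algebraic (exp l)" "algebraic b" and b: "b \<notin> \<rat>"
  shows "\<not> algebraic (exp (b * l))"
proof
  assume "algebraic (exp (b * l))"
  then obtain B D where B: "order_basis B" and D: "D \<noteq> 0"
    and mem: "of_int D * b \<in> int_mod.span B" "of_int D * exp l \<in> int_mod.span B"
      "of_int D * exp (b * l) \<in> int_mod.span B"
    using common_order[of "{b, exp l, exp (b * l)}"] alg by auto
  obtain s where s: "s \<ge> 1" and size: "\<And>q M k m i j. i < q \<Longrightarrow> j < q \<Longrightarrow> m < M \<Longrightarrow>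
    size_le B (gelfond_bound s q M k)
      (of_int D ^ (k + 2 * q * M) * ((of_nat i + of_nat j * b) ^ k * (exp l ^ i * exp (b * l) ^ j) ^ m))"
    using gelfond_coefficient_size[OF B mem] by blast
  obtain K where K: "K \<ge> 1" and liouville: "\<And>\<xi> H. H \<ge> 1 \<Longrightarrow> size_le B H \<xi> \<Longrightarrow> \<xi> \<noteq> 0 \<Longrightarrow>
      1 / (K * H) ^ card B \<le> norm \<xi>"
    using order_basis_liouville[OF B] by blast
  define N where "N = card B"
  define M where "M = 2 * N + 4"
  have N0: "N > 0" using B by (auto simp: N_def order_basis_def card_gt_0_iff)
  have M0: "M > 0" by (simp add: M_def)
  define g where "g = sqrt (2 * real M * real N)"
  define \<mu> where "\<mu> = 4 * real M * real N"
  define \<kappa> where "\<kappa> = 2 * g * s ^ (2 * M + 2)"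
  define \<epsilon> where "\<epsilon> = exp (g * (1 + norm b) * norm l)"
  define d where "d = real_of_int \<bar>D\<bar>"
  define \<eta> where "\<eta> = 2 * \<mu>\<^sup>2 * \<kappa>\<^sup>2"
  define \<delta> where "\<delta> = d ^ (1 + 2 * M) * (K * \<eta>) ^ N"
  define \<Theta> where "\<Theta> = (2 * real M) ^ M * (2 * \<mu>\<^sup>2 * \<kappa> * \<epsilon>) * \<delta>"
  define c where "c = max (2 * real M) (2 ^ M * \<Theta> / norm l)"
  have g0: "g > 0" using N0 M0 by (simp add: g_def)
  have \<mu>0: "\<mu> \<ge> 0" by (simp add: \<mu>_def)
  have \<kappa>0: "\<kappa> \<ge> 0" using g0 s by (simp add: \<kappa>_def)
  have d1: "d \<ge> 1" using D by (simp add: d_def)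
  have \<eta>0: "\<eta> \<ge> 0" by (simp add: \<eta>_def)
  have \<delta>0: "\<delta> \<ge> 0" using d1 K \<eta>0 by (simp add: \<delta>_def)
  have \<Theta>0: "\<Theta> \<ge> 0" using \<delta>0 \<kappa>0 by (simp add: \<Theta>_def \<epsilon>_def)
  \<comment> \<open>All constants, in particular \<open>c\<close>, are fixed before
    \<open>t\<close>, so arbitrarily large \<open>T\<close> with \<open>sqrt T \<le> c\<close> are
    absurd.\<close>
  have "\<exists>T\<ge>t. sqrt (real T) \<le> c" if t: "t > 0" for t :: nat
  proof -
    define q where "q = 2 * M * N * t"
    define n where "n = 2 * M * N * t\<^sup>2"
    obtain p T m0 V where aux: "n \<le> T" "m0 < M" "V \<noteq> 0"
      "\<And>i j. i < q \<Longrightarrow> j < q \<Longrightarrow> real_of_int \<bar>p (i, j)\<bar> \<le> 2 * real (q\<^sup>2) * gelfond_bound s q M n"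
      "\<And>k m. k < T \<Longrightarrow> m < M \<Longrightarrow> (deriv ^^ k) (gelfond_fun q p b l) (of_nat m) = 0"
      "(deriv ^^ T) (gelfond_fun q p b l) (of_nat m0) = l ^ T * V"
      "size_le B (real (q\<^sup>2) * (2 * real (q\<^sup>2) * gelfond_bound s q M n) * gelfond_bound s q M T)
         (of_int D ^ (T + 2 * q * M) * V)"
      using gelfond_auxiliary_function[OF B N_def M0 t q_def n_def b D s size] by blast
    define r where "r = sqrt (real T)"
    have q0: "q > 0" using N0 M0 t by (simp add: q_def)
    have qn: "q \<le> n" using t by (simp add: q_def n_def power2_eq_square)
    have tq: "t \<le> q" using N0 M0 by (simp add: q_def)
    have T: "q \<le> T" "T > 0" "t \<le> T" using q0 qn tq aux(1) by linarith+
    have r2: "r\<^sup>2 = real T" by (simp add: r_def)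
    have r0: "r > 0" using T by (simp add: r_def)
    have "q\<^sup>2 = 2 * M * N * n" by (simp add: q_def n_def power2_eq_square)
    then have q2: "real (q\<^sup>2) = 2 * real M * real N * real n" by simp
    then have q2T: "real (q\<^sup>2) \<le> 2 * real M * real N * real T"
      using aux(1) by (simp add: mult_left_mono)
    have qgr: "real q \<le> g * r"
    proof (rule power2_le_imp_le)
      show "(real q)\<^sup>2 \<le> (g * r)\<^sup>2" using q2T by (simp add: power_mult_distrib g_def r2)
    qed (use g0 r0 in simp)
    have q\<mu>: "real (q\<^sup>2) \<le> \<mu> ^ T"
    proof -
      \<comment> \<open>Both factors of \<open>(2 * M * N) * T\<close> are absorbed in
        \<open>T\<close>-th powers, the second by \<open>T \<le> 2 ^ T\<close>; this explains
        \<mu>.\<close>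
      have "1 \<le> M * N" using M0 N0 by (simp add: Suc_le_eq)
      then have "1 \<le> real (M * N)" by linarith
      then have "2 * real M * real N \<le> (2 * real M * real N) ^ T" using T by (intro self_le_power) auto
      moreover have "real T \<le> 2 ^ T" using of_nat_less_two_power[of T, where ?'a = real] by linarith
      ultimately have "2 * real M * real N * real T \<le> (2 * real M * real N) ^ T * 2 ^ T"
        by (intro mult_mono) auto
      also have "\<dots> = \<mu> ^ T" by (simp add: \<mu>_def mult_ac flip: power_mult_distrib)
      finally show ?thesis using q2T by linarith
    qed
    define P where "P = 2 * real (q\<^sup>2) * gelfond_bound s q M n"
    have Ab: "gelfond_bound s q M k \<le> (\<kappa> * r) ^ T" if "k \<le> T" for k
      using gelfond_bound_le[OF s q0 T(1) qgr that, of M] by (simp add: \<kappa>_def)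
    note A1 = gelfond_bound_ge_1[OF s q0, of M]
    have q1: "real (q\<^sup>2) \<ge> 1" using q0 by (simp add: Suc_le_eq)
    have "1 * 1 \<le> P" unfolding P_def using q1 A1 by (intro mult_mono) auto
    then have P1: "P \<ge> 1" by simp
    have P_le: "P \<le> (2 * \<mu> * \<kappa> * r) ^ T"
    proof -
      have "(2::real) \<le> 2 ^ T" using T by (intro self_le_power) auto
      then have "P \<le> 2 ^ T * \<mu> ^ T * (\<kappa> * r) ^ T"
        unfolding P_def using q\<mu> Ab[OF aux(1)] \<mu>0 A1[of n] by (intro mult_mono) auto
      also have "\<dots> = (2 * \<mu> * \<kappa> * r) ^ T" by (simp only: power_mult_distrib mult.assoc)
      finally show ?thesis .
    qed
    define H where "H = real (q\<^sup>2) * P * gelfond_bound s q M T"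
    have "1 * 1 * 1 \<le> H" unfolding H_def using q1 P1 A1 by (intro mult_mono) auto
    then have H1: "H \<ge> 1" by simp
    have H_le: "H \<le> (\<eta> * r\<^sup>2) ^ T"
    proof -
      have "H \<le> \<mu> ^ T * (2 * \<mu> * \<kappa> * r) ^ T * (\<kappa> * r) ^ T"
        unfolding H_def using q\<mu> P_le Ab[of T] P1 A1[of T] \<mu>0 \<kappa>0 r0 by (intro mult_mono) auto
      also have "\<dots> = (\<mu> * (2 * \<mu> * \<kappa> * r) * (\<kappa> * r)) ^ T" by (simp only: power_mult_distrib)
      also have "\<mu> * (2 * \<mu> * \<kappa> * r) * (\<kappa> * r) = \<eta> * r\<^sup>2"
        by (simp add: \<eta>_def power2_eq_square)
      finally show ?thesis .
    qed
    \<comment> \<open>The Liouville inequality is applied to the nonzero ring element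
      \<open>D ^ (T + 2 * q * M) * V\<close>; \<open>q \<le> T\<close> turns the power of
      \<open>d\<close> into a \<open>T\<close>-th power.\<close>
    have lower: "1 \<le> norm V * (\<delta> * r ^ (2 * N)) ^ T"
    proof -
      have "1 / (K * H) ^ N \<le> norm (of_int D ^ (T + 2 * q * M) * V)"
        unfolding N_def using H1 aux(3,7) D by (intro liouville) (auto simp: H_def P_def)
      also have "\<dots> = d ^ (T + 2 * q * M) * norm V"
        by (simp add: norm_mult norm_power d_def)
      finally have 1: "1 \<le> d ^ (T + 2 * q * M) * norm V * (K * H) ^ N"
        using K H1 by (simp add: divide_le_eq)
      have "d ^ (T + 2 * q * M) \<le> d ^ ((1 + 2 * M) * T)"
        using d1 T by (intro power_increasing) (auto simp: algebra_simps)
      moreover have "(K * H) ^ N \<le> (K ^ T * (\<eta> * r\<^sup>2) ^ T) ^ N"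
        using K H_le H1 T by (intro power_mono mult_mono self_le_power) auto
      ultimately have "d ^ (T + 2 * q * M) * norm V * (K * H) ^ N \<le>
          d ^ ((1 + 2 * M) * T) * norm V * (K ^ T * (\<eta> * r\<^sup>2) ^ T) ^ N"
        using K H1 d1 by (intro mult_mono) auto
      also have "(K ^ T * (\<eta> * r\<^sup>2) ^ T) ^ N = ((K * \<eta> * r\<^sup>2) ^ N) ^ T"
      proof -
        have "K ^ T * (\<eta> * r\<^sup>2) ^ T = (K * \<eta> * r\<^sup>2) ^ T" by (simp only: power_mult_distrib mult.assoc)
        then show ?thesis by (simp only: power_mult[symmetric] mult.commute[of T N])
      qed
      also have "(K * \<eta> * r\<^sup>2) ^ N = (K * \<eta>) ^ N * r ^ (2 * N)"
        by (simp only: power_mult_distrib power_mult)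
      also have "d ^ ((1 + 2 * M) * T) * norm V * ((K * \<eta>) ^ N * r ^ (2 * N)) ^ T =
          norm V * (\<delta> * r ^ (2 * N)) ^ T"
        unfolding power_mult[of d "1 + 2 * M" T] \<delta>_def by (simp only: power_mult_distrib mult_ac)
      finally show ?thesis using 1 by linarith
    qed
    have "r \<le> c"
    proof (cases "r \<le> 2 * real M")
      \<comment> \<open>As \<open>r > 2 * M\<close>, the disc of radius \<open>r\<close> contains
        all the zeros and \<open>r - M \<ge> r / 2\<close>. The other case is covered by the maximum
        in \<open>c\<close>.\<close>
      case False
      let ?Kb = "real (q\<^sup>2) * (P * exp (real q * (1 + norm b) * norm l * r))"
      have hol: "gelfond_fun q p b l holomorphic_on UNIV"
        unfolding gelfond_fun_def by (auto intro!: holomorphic_intros simp: case_prod_unfold)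
      have cardZ: "card ((of_nat :: nat \<Rightarrow> complex) ` {..<M}) = M"
        by (simp add: card_image inj_on_def)
      have "norm ((deriv ^^ T) (gelfond_fun q p b l) (of_nat m0)) \<le>
          fact T * (2 * real M) ^ (T * card ((of_nat :: nat \<Rightarrow> complex) ` {..<M})) *
            (?Kb / (r - real M) ^ (T * card ((of_nat :: nat \<Rightarrow> complex) ` {..<M})))"
      proof (rule higher_deriv_bound_many_zeros[OF hol])
        show "norm (gelfond_fun q p b l z) \<le> ?Kb" if "norm z = r" for z
          unfolding that[symmetric]
        proof (rule gelfond_fun_norm_le)
          show "real_of_int \<bar>p (i, j)\<bar> \<le> P" if "i < q" "j < q" for i j
            unfolding P_def by (rule aux(4)[OF that])
          show "P \<ge> 0" using P1 by linarith
        qed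
      qed (use aux(2,5) M0 False in auto)
      then have "norm l ^ T * norm V \<le> fact T * (2 * real M) ^ (T * M) * (?Kb / (r - real M) ^ (T * M))"
        unfolding cardZ aux(6) by (simp add: norm_mult norm_power)
      also have "\<dots> \<le> fact T * (2 * real M) ^ (T * M) * (?Kb / (r / 2) ^ (T * M))"
        using False P1 r0
        by (intro mult_left_mono divide_left_mono power_mono mult_pos_pos zero_less_power) auto
      also have "\<dots> = fact T * (2 * real M) ^ (T * M) * ?Kb / (r / 2) ^ (T * M)"
        by (simp only: times_divide_eq_right)
      finally have 1: "norm l ^ T * norm V * (r / 2) ^ (T * M) \<le> fact T * (2 * real M) ^ (T * M) * ?Kb"
        using r0 by (subst (asm) pos_le_divide_eq) simp_all
      have Kb: "?Kb \<le> \<mu> ^ T * ((2 * \<mu> * \<kappa> * r) ^ T * \<epsilon> ^ T)"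
      proof (intro mult_mono q\<mu> P_le)
        \<comment> \<open>This is why the radius is \<open>sqrt T\<close>: the exponent on the
          circle grows only linearly in \<open>T\<close>.\<close>
        have "real q * r \<le> g * r * r" using qgr r0 by (intro mult_right_mono) auto
        also have "\<dots> = g * real T" by (simp add: r2[symmetric] power2_eq_square)
        finally have "real q * r * ((1 + norm b) * norm l) \<le> g * real T * ((1 + norm b) * norm l)"
          by (rule mult_right_mono) simp
        then have "exp (real q * (1 + norm b) * norm l * r) \<le> exp (real T * (g * (1 + norm b) * norm l))"
          by (simp add: mult_ac)
        then show "exp (real q * (1 + norm b) * norm l * r) \<le> \<epsilon> ^ T"
          by (simp add: \<epsilon>_def exp_of_nat_mult)
      qed (use \<mu>0 \<kappa>0 r0 P1 in auto)
      have "fact T \<le> real T ^ T" using fact_le_power[of T, where ?'a = real] by simp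
      then have fact: "fact T \<le> (r\<^sup>2) ^ T" by (simp add: r2)
      have nonneg: "0 \<le> (\<delta> * r ^ (2 * N)) ^ T" using \<delta>0 r0 by simp
      have "norm l ^ T * (r / 2) ^ (T * M) \<le>
          norm l ^ T * (r / 2) ^ (T * M) * (norm V * (\<delta> * r ^ (2 * N)) ^ T)"
        using mult_left_mono[OF lower, of "norm l ^ T * (r / 2) ^ (T * M)"] r0 by simp
      also have "\<dots> = norm l ^ T * norm V * (r / 2) ^ (T * M) * (\<delta> * r ^ (2 * N)) ^ T"
        by (simp only: mult_ac)
      also have "\<dots> \<le> fact T * (2 * real M) ^ (T * M) * ?Kb * (\<delta> * r ^ (2 * N)) ^ T"
        using 1 nonneg by (rule mult_right_mono)
      also have "\<dots> \<le> (r\<^sup>2) ^ T * (2 * real M) ^ (T * M) * (\<mu> ^ T * ((2 * \<mu> * \<kappa> * r) ^ T * \<epsilon> ^ T)) *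
          (\<delta> * r ^ (2 * N)) ^ T"
        using nonneg P1 by (intro mult_right_mono mult_mono fact Kb) auto
      also have "\<dots> = (r\<^sup>2 * (2 * real M) ^ M * (\<mu> * ((2 * \<mu> * \<kappa> * r) * \<epsilon>)) * (\<delta> * r ^ (2 * N))) ^ T"
        by (simp only: power_mult_distrib power_mult[symmetric] mult.commute[of T])
      also have "r\<^sup>2 * (2 * real M) ^ M * (\<mu> * ((2 * \<mu> * \<kappa> * r) * \<epsilon>)) * (\<delta> * r ^ (2 * N)) =
          \<Theta> * r ^ (2 * N + 3)"
        by (simp add: \<Theta>_def power_add power2_eq_square power3_eq_cube)
      also have "norm l ^ T * (r / 2) ^ (T * M) = (norm l * (r / 2) ^ M) ^ T"
        by (simp only: power_mult_distrib power_mult[symmetric] mult.commute[of T])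
      finally have "(norm l * (r / 2) ^ M) ^ T \<le> (\<Theta> * r ^ (2 * N + 3)) ^ T" .
      moreover have "0 \<le> norm l * (r / 2) ^ M" "0 \<le> \<Theta> * r ^ (2 * N + 3)" using r0 \<Theta>0 by auto
      ultimately have "norm l * (r / 2) ^ M \<le> \<Theta> * r ^ (2 * N + 3)"
        using T(2) power_mono_iff by blast
      \<comment> \<open>By \<open>M = 2 * N + 4\<close> exactly one factor \<open>r\<close> remains
        after cancellation.\<close>
      moreover have "(r / 2) ^ M = r * r ^ (2 * N + 3) / 2 ^ M"
        by (simp add: M_def power_divide power_add eval_nat_numeral)
      ultimately have "norm l * r * r ^ (2 * N + 3) \<le> 2 ^ M * \<Theta> * r ^ (2 * N + 3)"
        by (simp add: field_simps)
      then have "norm l * r \<le> 2 ^ M * \<Theta>" using r0 by simp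
      then have "r \<le> 2 ^ M * \<Theta> / norm l" using l by (simp add: field_simps)
      then show ?thesis by (simp add: c_def)
    qed (simp add: c_def)
    then show ?thesis using T(3) by (auto simp: r_def)
  qed
  then obtain T where T: "nat \<lceil>c\<^sup>2\<rceil> + 1 \<le> T" "sqrt (real T) \<le> c" by (metis zero_less_Suc Suc_eq_plus1)
  have "real T = (sqrt (real T))\<^sup>2" by simp
  also have "\<dots> \<le> c\<^sup>2" using T(2) by (intro power_mono) auto
  finally show False using T(1) by linarith
qed

section \<open>Linear independence of 1, cosine and sine\<close>

theorem theorem7:
  fixes \<alpha> \<beta> :: complex
  assumes "algebraic \<alpha>" and "algebraic \<beta>"
    and "\<alpha> \<noteq> 0" and "\<alpha> \<noteq> 1"
    and "\<i> * \<beta> \<notin> \<rat>"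
  shows "lin_indep_over {x :: complex. algebraic x} [1, cos (\<beta> * Ln \<alpha>), sin (\<beta> * Ln \<alpha>)] \<and>
         \<not> algebraic (cos (\<beta> * Ln \<alpha>)) \<and> \<not> algebraic (sin (\<beta> * Ln \<alpha>))"
proof -
  define x where "x = \<beta> * Ln \<alpha>"
  define w where "w = exp (\<i> * x)"
  have "Ln \<alpha> \<noteq> 0" using exp_Ln[OF assms(3)] assms(4) by auto
  moreover have "algebraic (exp (Ln \<alpha>))" using assms by simp
  \<comment> \<open>Gelfond--Schneider is used with exponent \<open>\<i> * \<beta>\<close> and
    logarithm \<open>Ln \<alpha>\<close>, which is nonzero because \<alpha> differs from 1.\<close>
  ultimately have "\<not> algebraic (exp (\<i> * \<beta> * Ln \<alpha>))"
    using assms by (intro gelfond_schneider algebraic_mult) auto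
  then have w: "\<not> algebraic w" by (simp add: w_def x_def mult.assoc)
  have w0: "w \<noteq> 0" by (simp add: w_def)
  have cosx: "cos x = (w + inverse w) / 2" and sinx: "sin x = (w - inverse w) / (2 * \<i>)"
    by (simp_all add: w_def cos_exp_eq sin_exp_eq exp_minus)
  have indep: "c0 = 0 \<and> c1 = 0 \<and> c2 = 0"
    if alg: "algebraic c0" "algebraic c1" "algebraic c2" and eq: "c0 + c1 * cos x + c2 * sin x = 0" for c0 c1 c2
  proof -
    \<comment> \<open>\<open>A\<close>, \<open>2 * c0\<close> and \<open>C\<close> are the
      coefficients obtained by multiplying the relation by \<open>2 * w\<close>; \<open>A\<close>
      and \<open>C\<close> together determine \<open>c1\<close> and \<open>c2\<close>.\<close>
    define A where "A = c1 + - (\<i> * c2)"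
    define C where "C = c1 + \<i> * c2"
    have "A * w\<^sup>2 + (2 * c0) * w + C = 2 * w * (c0 + c1 * cos x + c2 * sin x)"
      using w0 by (simp add: cosx sinx A_def C_def power2_eq_square field_simps)
    then have "A * w\<^sup>2 + (2 * c0) * w + C = 0" using eq by simp
    moreover have "algebraic A" "algebraic (2 * c0)" "algebraic C"
      unfolding A_def C_def using alg by (intro algebraic_add algebraic_mult algebraic_minus; simp)+
    ultimately have z: "A = 0" "2 * c0 = 0" "C = 0" using algebraic_quadratic_root w by blast+
    have "2 * c1 = A + C" "2 * (\<i> * c2) = C - A" by (simp_all add: A_def C_def)
    then show ?thesis using z by simp
  qed
  have "lin_indep_over {x :: complex. algebraic x} [1, cos x, sin x]"
    unfolding lin_indep_over_def
  proof (intro allI impI)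
    fix c :: "nat \<Rightarrow> complex" and i
    assume c: "\<forall>i<length [1, cos x, sin x]. c i \<in> {x. algebraic x}"
      and sum: "(\<Sum>i<length [1, cos x, sin x]. c i * [1, cos x, sin x] ! i) = 0"
      and i: "i < length [1, cos x, sin x]"
    have "c 0 + c 1 * cos x + c 2 * sin x = 0" using sum by (simp add: eval_nat_numeral)
    then have "c 0 = 0 \<and> c 1 = 0 \<and> c 2 = 0" using c by (intro indep) auto
    moreover have "i = 0 \<or> i = 1 \<or> i = 2" using i by auto
    ultimately show "c i = 0" by auto
  qed
  \<comment> \<open>An algebraic cosine would itself be a coefficient in the relation
    \<open>- cos x + 1 * cos x + 0 * sin x = 0\<close>.\<close>
  moreover have "\<not> algebraic (cos x)" using indep[of "- cos x" 1 0] by auto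
  moreover have "\<not> algebraic (sin x)" using indep[of "- sin x" 0 1] by auto
  ultimately show ?thesis by (simp add: x_def)
qed

end
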